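(* Let $n\ge 1$ and let $a$ and $b$ be non-zero elements of $\mathbb{C}_n^\perp\subset A_n$. If $\{a,b\}$ does not belong to the $D$-locus in $A_{n+1}$, then $\dim\mathrm{Ann}\{a,b\}=\dim\mathrm{Ann}(a)+\dim\mathrm{Ann}(b)$. If $\{a,b\}$ belongs to the $D$-locus in $A_{n+1}$, then $\dim\mathrm{Ann}\{a,b\}=\dim\mathrm{Ann}(a)+\dim\mathrm{Ann}(b)+4$.
   Context: The Cayley-Dickson algebras $A_n$ are real algebras with involution defined inductively: $A_0=\mathbb{R}$ with trivial conjugation, and $A_n=A_{n-1}\times A_{n-1}$ additively, with $(a,b)^*=(a^*,-b)$ and $(a,b)(c,d)=(ac-d^*b,\;da+bc^* )$. For $n\ge 1$ put $i_n=(0,1)\in A_n$, and let $\mathbb{C}_n$ be the $\mathbb{R}$-linear span of $1=(1,0)$ and $i_n$. The real inner product is $\langle a,b\rangle_{\mathbb{R}}=\mathrm{Re}(ab^* )$, where $\mathrm{Re}(x)=\frac12(x+x^* )$; "orthogonal" refers to it. The Hermitian inner product $\langle a,b\rangle_{\mathbb{C}}$ is the orthogonal projection of $ab^*$ onto $\mathbb{C}_n$; $a,b$ are $\mathbb{C}$-orthogonal if $\langle a,b\rangle_{\mathbb{C}}=0$. $\mathbb{C}_n^\perp$ is the orthogonal complement of $\mathbb{C}_n$ in $A_n$. For $a,b\in\mathbb{C}_n^\perp$, $\{a,b\}$ denotes the element $\frac{1}{\sqrt2}\big(a+b,\;i_n(-a+b)\big)$ of $A_{n+1}$. For $x\in A_m$,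 $\mathrm{Ann}(x)=\{y\in A_m: xy=0\}$; dimensions are over $\mathbb{R}$. The $D$-locus in $A_{n+1}$ is the space of all elements $\{a,b\}$ with $a,b\in\mathbb{C}_n^\perp$ such that (1) $a$ and $b$ are $\mathbb{C}$-orthogonal, (2) $a$ is orthogonal to $\mathrm{Ann}(b)$, and (3) $b$ is orthogonal to $\mathrm{Ann}(a)$ (annihilators taken in $A_n$). *)

theory Defs
  imports "HOL-Analysis.Analysis" "HOL-Analysis.Finite_Function_Topology"
begin

text \<open>
  All Cayley--Dickson algebras live in one ambient real vector space, the finitely supported
  real sequences: \<open>cd_carrier n\<close> (that is, \<open>A\<^sub>n\<close>) consists of those supported in \<open>{..<2 ^ n}\<close>, and
  the pair \<open>(a, b)\<close> of elements of \<open>A\<^sub>n\<close> is the concatenation \<open>cd_pair n a b\<close>, in \<open>A\<^bsub>n+1\<^esub>\<close>.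
  Addition and scalar multiplication are those of the library type; its product \<open>*\<close>
  (convolution) is not the Cayley--Dickson product.  Elements of \<open>A\<^sub>0\<close> are the real numbers
  stored at index 0.
\<close>

type_synonym cd = "nat \<Rightarrow>\<^sub>0 real"

definition cd_carrier :: "nat \<Rightarrow> cd set" where
  "cd_carrier n = {x. Poly_Mapping.keys x \<subseteq> {..<2 ^ n}}"

lift_definition cd_fst :: "nat \<Rightarrow> cd \<Rightarrow> cd" is
  "\<lambda>n x k. if k < 2 ^ n then x k else 0"
  by (rule finite_subset[rotated]) auto

lift_definition cd_snd :: "nat \<Rightarrow> cd \<Rightarrow> cd" is
  "\<lambda>n x k. x (k + 2 ^ n)"
proof -
  fix n :: nat and x :: "nat \<Rightarrow> real"
  assume "finite {k. x k \<noteq> 0}"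
  then have "finite ((\<lambda>k. k + 2 ^ n) -` {k. x k \<noteq> 0})"
    by (rule finite_vimageI) simp
  then show "finite {k. x (k + 2 ^ n) \<noteq> 0}"
    by (simp add: vimage_def)
qed

lift_definition cd_pair :: "nat \<Rightarrow> cd \<Rightarrow> cd \<Rightarrow> cd" is
  "\<lambda>n a b k. if k < 2 ^ n then a k else b (k - 2 ^ n)"
proof -
  fix n :: nat and a b :: "nat \<Rightarrow> real"
  assume "finite {k. a k \<noteq> 0}" "finite {k. b k \<noteq> 0}"
  then have "finite ({k. a k \<noteq> 0} \<union> (\<lambda>k. k + 2 ^ n) ` {k. b k \<noteq> 0})"
    by blast
  then show "finite {k. (if k < 2 ^ n then a k else b (k - 2 ^ n)) \<noteq> 0}"
  proof (rule finite_subset[rotated], intro subsetI)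
    fix k
    assume k: "k \<in> {k. (if k < 2 ^ n then a k else b (k - 2 ^ n)) \<noteq> 0}"
    show "k \<in> {k. a k \<noteq> 0} \<union> (\<lambda>k. k + 2 ^ n) ` {k. b k \<noteq> 0}"
    proof (cases "k < 2 ^ n")
      case False
      then have "k = (k - 2 ^ n) + 2 ^ n" "b (k - 2 ^ n) \<noteq> 0"
        using k by auto
      then show ?thesis by blast
    qed (use k in auto)
  qed
qed

primrec cd_one :: "nat \<Rightarrow> cd" where
  "cd_one 0 = Poly_Mapping.single 0 1"
| "cd_one (Suc n) = cd_pair n (cd_one n) 0"

primrec cd_conj :: "nat \<Rightarrow> cd \<Rightarrow> cd" where
  "cd_conj 0 x = x"
| "cd_conj (Suc n) x = cd_pair n (cd_conj n (cd_fst n x)) (- cd_snd n x)"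

primrec cd_mult :: "nat \<Rightarrow> cd \<Rightarrow> cd \<Rightarrow> cd" where
  "cd_mult 0 x y = Poly_Mapping.single 0 (Poly_Mapping.lookup x 0 * Poly_Mapping.lookup y 0)"
| "cd_mult (Suc n) x y =
     (let a = cd_fst n x; b = cd_snd n x; c = cd_fst n y; d = cd_snd n y
      in cd_pair n (cd_mult n a c - cd_mult n (cd_conj n d) b)
                   (cd_mult n d a + cd_mult n b (cd_conj n c)))"

text \<open>Meaningful only for \<open>n \<ge> 1\<close>.\<close>

definition cd_i :: "nat \<Rightarrow> cd" where
  "cd_i n = cd_pair (n - 1) 0 (cd_one (n - 1))"

definition cd_C :: "nat \<Rightarrow> cd set" where
  "cd_C n = span {cd_one n, cd_i n}"

definition cd_Re :: "nat \<Rightarrow> cd \<Rightarrow> cd" where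
  "cd_Re n x = (1 / 2) *\<^sub>R (x + cd_conj n x)"

text \<open>The real inner product, with values in the real multiples of \<open>1\<close> in \<open>A\<^sub>n\<close>.\<close>

definition cd_inner :: "nat \<Rightarrow> cd \<Rightarrow> cd \<Rightarrow> cd" where
  "cd_inner n a b = cd_Re n (cd_mult n a (cd_conj n b))"

definition cd_orthogonal :: "nat \<Rightarrow> cd \<Rightarrow> cd \<Rightarrow> bool" where
  "cd_orthogonal n a b \<longleftrightarrow> cd_inner n a b = 0"

definition cd_C_perp :: "nat \<Rightarrow> cd set" where
  "cd_C_perp n = {x \<in> cd_carrier n. \<forall>c\<in>cd_C n. cd_orthogonal n x c}"

text \<open>
  The orthogonal projection onto \<open>\<complex>\<^sub>n\<close>; see \<open>cd_proj_C_unique\<close> below for its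
  existence and uniqueness.
\<close>

definition cd_proj_C :: "nat \<Rightarrow> cd \<Rightarrow> cd" where
  "cd_proj_C n x = (THE p. p \<in> cd_C n \<and> (\<forall>c\<in>cd_C n. cd_orthogonal n (x - p) c))"

definition cd_hermitian :: "nat \<Rightarrow> cd \<Rightarrow> cd \<Rightarrow> cd" where
  "cd_hermitian n a b = cd_proj_C n (cd_mult n a (cd_conj n b))"

definition cd_C_orthogonal :: "nat \<Rightarrow> cd \<Rightarrow> cd \<Rightarrow> bool" where
  "cd_C_orthogonal n a b \<longleftrightarrow> cd_hermitian n a b = 0"

definition cd_Ann :: "nat \<Rightarrow> cd \<Rightarrow> cd set" where
  "cd_Ann n x = {y \<in> cd_carrier n. cd_mult n x y = 0}"

text \<open>The element \<open>{a, b}\<close> of \<open>A\<^bsub>n+1\<^esub>\<close>.\<close>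

definition cd_brace :: "nat \<Rightarrow> cd \<Rightarrow> cd \<Rightarrow> cd" where
  "cd_brace n a b = (1 / sqrt 2) *\<^sub>R cd_pair n (a + b) (cd_mult n (cd_i n) (- a + b))"

text \<open>\<open>D_locus n\<close> is the \<open>D\<close>-locus in \<open>A\<^bsub>n+1\<^esub>\<close>.\<close>

definition D_locus :: "nat \<Rightarrow> cd set" where
  "D_locus n = {cd_brace n a b | a b.
     a \<in> cd_C_perp n \<and> b \<in> cd_C_perp n \<and>
     cd_C_orthogonal n a b \<and>
     (\<forall>y\<in>cd_Ann n b. cd_orthogonal n a y) \<and>
     (\<forall>y\<in>cd_Ann n a. cd_orthogonal n b y)}"


lemma cd_carrier_iff: "x \<in> cd_carrier n \<longleftrightarrow> (\<forall>k\<ge>2 ^ n. Poly_Mapping.lookup x k = 0)"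
  by (auto simp: cd_carrier_def in_keys_iff) (metis linorder_not_less)

lemma lookup_scaleR [simp]:
  "Poly_Mapping.lookup (r *\<^sub>R x) k = r *\<^sub>R Poly_Mapping.lookup x k"
proof -
  have "finite {i. r *\<^sub>R Poly_Mapping.lookup x i \<noteq> 0}"
    by (rule finite_subset[OF _ finite_lookup[of x]]) auto
  then show ?thesis
    by (simp add: scaleR_poly_mapping_def Abs_poly_mapping_inverse)
qed

lemma subspace_cd_carrier: "subspace (cd_carrier n)"
  by (auto simp: subspace_def cd_carrier_iff lookup_add)

lemma cd_pair_in_carrier:
  "b \<in> cd_carrier n \<Longrightarrow> cd_pair n a b \<in> cd_carrier (Suc n)"
  by (auto simp: cd_carrier_iff cd_pair.rep_eq)

lemma cd_fst_in_carrier: "cd_fst n x \<in> cd_carrier n"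
  by (auto simp: cd_carrier_iff cd_fst.rep_eq)

lemma cd_snd_in_carrier: "x \<in> cd_carrier (Suc n) \<Longrightarrow> cd_snd n x \<in> cd_carrier n"
  by (auto simp: cd_carrier_iff cd_snd.rep_eq)

lemma cd_fst_pair: "a \<in> cd_carrier n \<Longrightarrow> cd_fst n (cd_pair n a b) = a"
  by (rule poly_mapping_eqI) (auto simp: cd_carrier_iff cd_fst.rep_eq cd_pair.rep_eq)

lemma cd_snd_pair: "cd_snd n (cd_pair n a b) = b"
  by (rule poly_mapping_eqI) (auto simp: cd_snd.rep_eq cd_pair.rep_eq)

lemma cd_pair_fst_snd: "cd_pair n (cd_fst n x) (cd_snd n x) = x"
  by (rule poly_mapping_eqI) (auto simp: cd_fst.rep_eq cd_snd.rep_eq cd_pair.rep_eq)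

lemma cd_conj_pair:
  "a \<in> cd_carrier n \<Longrightarrow> cd_conj (Suc n) (cd_pair n a b) = cd_pair n (cd_conj n a) (- b)"
  by (simp add: cd_fst_pair cd_snd_pair)

lemma cd_mult_pair:
  "a \<in> cd_carrier n \<Longrightarrow> c \<in> cd_carrier n \<Longrightarrow>
   cd_mult (Suc n) (cd_pair n a b) (cd_pair n c d) =
     cd_pair n (cd_mult n a c - cd_mult n (cd_conj n d) b)
               (cd_mult n d a + cd_mult n b (cd_conj n c))"
  by (simp add: cd_fst_pair cd_snd_pair)

lemma cd_one_eq: "cd_one n = Poly_Mapping.single 0 1"
  by (induction n)
     (auto intro!: poly_mapping_eqI simp: cd_pair.rep_eq lookup_single when_def simp del: single_one)

lemma cd_one_in_carrier: "cd_one n \<in> cd_carrier n"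
  by (auto simp: cd_one_eq cd_carrier_iff lookup_single when_def simp del: single_one)

lemma cd_conj_in_carrier: "x \<in> cd_carrier n \<Longrightarrow> cd_conj n x \<in> cd_carrier n"
proof (induction n arbitrary: x)
  case (Suc n)
  then show ?case
    by (auto intro!: cd_pair_in_carrier subspace_neg[OF subspace_cd_carrier] cd_snd_in_carrier)
qed simp

lemma cd_mult_in_carrier:
  "x \<in> cd_carrier n \<Longrightarrow> y \<in> cd_carrier n \<Longrightarrow> cd_mult n x y \<in> cd_carrier n"
proof (induction n arbitrary: x y)
  case 0
  then show ?case
    by (auto simp: cd_carrier_iff lookup_single when_def)
next
  case (Suc n)
  then show ?case
    by (auto simp: Let_def intro!: cd_pair_in_carrier subspace_add[OF subspace_cd_carrier]
        cd_fst_in_carrier cd_snd_in_carrier cd_conj_in_carrier)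
qed

lemma cd_i_in_carrier: "n \<ge> 1 \<Longrightarrow> cd_i n \<in> cd_carrier n"
  using cd_pair_in_carrier[OF cd_one_in_carrier, of "n - 1" 0] by (simp add: cd_i_def)

lemma cd_brace_in_carrier:
  "n \<ge> 1 \<Longrightarrow> a \<in> cd_carrier n \<Longrightarrow> b \<in> cd_carrier n \<Longrightarrow> cd_brace n a b \<in> cd_carrier (Suc n)"
  unfolding cd_brace_def
  by (intro subspace_scale subspace_cd_carrier cd_pair_in_carrier cd_mult_in_carrier
      cd_i_in_carrier subspace_add subspace_neg)

lemma cd_fst_zero [simp]: "cd_fst n 0 = 0"
  by (rule poly_mapping_eqI) (simp add: cd_fst.rep_eq)

lemma cd_snd_zero [simp]: "cd_snd n 0 = 0"
  by (rule poly_mapping_eqI) (simp add: cd_snd.rep_eq)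

lemma cd_pair_zero [simp]: "cd_pair n 0 0 = 0"
  by (rule poly_mapping_eqI) (simp add: cd_pair.rep_eq)

lemma cd_conj_zero [simp]: "cd_conj n 0 = 0"
  by (induction n) simp_all

lemma cd_mult_zero [simp]: "cd_mult n 0 x = 0" "cd_mult n x 0 = 0"
  by (induction n arbitrary: x) (simp_all add: Let_def)

lemma cd_conj_one: "cd_conj n (cd_one n) = cd_one n"
  by (induction n) (simp_all add: cd_fst_pair cd_snd_pair cd_one_in_carrier)

lemma cd_conj_neg: "cd_conj n (- x) = - cd_conj n x"
proof (induction n arbitrary: x)
  case (Suc n)
  have "cd_fst n (- x) = - cd_fst n x" "cd_snd n (- x) = - cd_snd n x"
    by (auto intro!: poly_mapping_eqI simp: cd_fst.rep_eq cd_snd.rep_eq)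
  with Suc show ?case
    by (auto intro!: poly_mapping_eqI simp: cd_pair.rep_eq)
qed simp

lemma cd_mult_one:
  assumes "x \<in> cd_carrier n"
  shows "cd_mult n x (cd_one n) = x" "cd_mult n (cd_one n) x = x"
proof -
  have "cd_mult n x (cd_one n) = x \<and> cd_mult n (cd_one n) x = x"
    using assms
  proof (induction n arbitrary: x)
    case 0
    then show ?case
      by (auto intro!: poly_mapping_eqI simp: cd_carrier_iff lookup_single when_def)
  next
    case (Suc n)
    then show ?case
      by (simp add: Let_def cd_fst_pair cd_snd_pair cd_one_in_carrier cd_conj_one
          cd_fst_in_carrier cd_snd_in_carrier cd_pair_fst_snd)
  qed
  then show "cd_mult n x (cd_one n) = x" "cd_mult n (cd_one n) x = x"
    by auto
qed

lemma cd_fst_linear: "cd_fst n (x + y) = cd_fst n x + cd_fst n y"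
  "cd_fst n (r *\<^sub>R x) = r *\<^sub>R cd_fst n x"
  by (auto intro!: poly_mapping_eqI simp: cd_fst.rep_eq lookup_add)

lemma cd_snd_linear: "cd_snd n (x + y) = cd_snd n x + cd_snd n y"
  "cd_snd n (r *\<^sub>R x) = r *\<^sub>R cd_snd n x"
  by (auto intro!: poly_mapping_eqI simp: cd_snd.rep_eq lookup_add)

lemma cd_pair_linear: "cd_pair n (a + a') (b + b') = cd_pair n a b + cd_pair n a' b'"
  "cd_pair n (r *\<^sub>R a) (r *\<^sub>R b) = r *\<^sub>R cd_pair n a b"
  by (auto intro!: poly_mapping_eqI simp: cd_pair.rep_eq lookup_add)

lemma cd_conj_linear: "cd_conj n (x + y) = cd_conj n x + cd_conj n y"
  "cd_conj n (r *\<^sub>R x) = r *\<^sub>R cd_conj n x"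
proof (induction n arbitrary: x y)
  case (Suc n)
  {
    case 1
    show ?case
      by (simp add: cd_fst_linear cd_snd_linear Suc cd_pair_linear(1)[symmetric])
  next
    case 2
    show ?case
      by (simp add: cd_fst_linear cd_snd_linear Suc cd_pair_linear(2)[symmetric])
  }
qed simp_all

lemma cd_mult_linear:
  "cd_mult n (x + x') y = cd_mult n x y + cd_mult n x' y"
  "cd_mult n x (y + y') = cd_mult n x y + cd_mult n x y'"
  "cd_mult n (r *\<^sub>R x) y = r *\<^sub>R cd_mult n x y"
  "cd_mult n x (r *\<^sub>R y) = r *\<^sub>R cd_mult n x y"
proof (induction n arbitrary: x x' y y')
  case 0
  {
    case 1 show ?case
      by (auto intro!: poly_mapping_eqI simp: lookup_single lookup_add when_def algebra_simps)
  next
    case 2 show ?case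
      by (auto intro!: poly_mapping_eqI simp: lookup_single lookup_add when_def algebra_simps)
  next
    case 3 show ?case
      by (auto intro!: poly_mapping_eqI simp: lookup_single lookup_add when_def algebra_simps)
  next
    case 4 show ?case
      by (auto intro!: poly_mapping_eqI simp: lookup_single lookup_add when_def algebra_simps)
  }
next
  case (Suc n)
  note lin = cd_fst_linear cd_snd_linear cd_conj_linear Suc
  {
    case 1 show ?case
      by (simp add: Let_def lin cd_pair_linear(1)[symmetric] algebra_simps)
  next
    case 2 show ?case
      by (simp add: Let_def lin cd_pair_linear(1)[symmetric] algebra_simps)
  next
    case 3 show ?case
      by (simp add: Let_def lin cd_pair_linear(2)[symmetric] algebra_simps)
  next
    case 4 show ?case
      by (simp add: Let_def lin cd_pair_linear(2)[symmetric] algebra_simps)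
  }
qed

lemma lookup_cd_conj:
  "x \<in> cd_carrier n \<Longrightarrow> Poly_Mapping.lookup (cd_conj n x) k =
     (if k = 0 then Poly_Mapping.lookup x 0 else - Poly_Mapping.lookup x k)"
proof (induction n arbitrary: x k)
  case 0
  then show ?case
    by (auto simp: cd_carrier_iff)
next
  case (Suc n)
  have "cd_fst n x \<in> cd_carrier n"
    by (rule cd_fst_in_carrier)
  from Suc.IH[OF this] show ?case
    by (auto simp: cd_pair.rep_eq cd_fst.rep_eq cd_snd.rep_eq)
qed

lemma cd_Re_eq:
  "x \<in> cd_carrier n \<Longrightarrow> cd_Re n x = Poly_Mapping.lookup x 0 *\<^sub>R cd_one n"
  by (auto intro!: poly_mapping_eqI simp: cd_Re_def lookup_add lookup_cd_conj cd_one_eq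
      lookup_single when_def simp del: single_one)

lemma cd_mult_conj_i:
  assumes "x \<in> cd_carrier (Suc m)"
  shows "cd_mult (Suc m) x (cd_conj (Suc m) (cd_i (Suc m))) =
    cd_pair m (cd_snd m x) (- cd_fst m x)"
proof -
  have 0: "(0::cd) \<in> cd_carrier m"
    by (simp add: cd_carrier_iff)
  have neg: "cd_mult m (- y) z = - cd_mult m y z" for y z
    using cd_mult_linear(3)[of m "-1" y z] by simp
  show ?thesis
    using assms
    by (simp add: cd_i_def Let_def cd_fst_pair cd_snd_pair 0 cd_conj_neg cd_conj_one neg
        cd_mult_one cd_fst_in_carrier cd_snd_in_carrier)
qed

lemma cd_C_iff: "c \<in> cd_C n \<longleftrightarrow> (\<exists>r s. c = r *\<^sub>R cd_one n + s *\<^sub>R cd_i n)"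
  by (auto simp: cd_C_def span_insert span_singleton algebra_simps)

lemma cd_orthogonal_C:
  assumes x: "x \<in> cd_carrier (Suc m)"
  shows "cd_orthogonal (Suc m) x (r *\<^sub>R cd_one (Suc m) + s *\<^sub>R cd_i (Suc m)) \<longleftrightarrow>
    r * Poly_Mapping.lookup x 0 + s * Poly_Mapping.lookup x (2 ^ m) = 0"
proof -
  let ?y = "r *\<^sub>R x + s *\<^sub>R cd_pair m (cd_snd m x) (- cd_fst m x)"
  have "- cd_fst m x \<in> cd_carrier m"
    by (simp add: subspace_neg subspace_cd_carrier cd_fst_in_carrier)
  then have y: "?y \<in> cd_carrier (Suc m)"
    by (intro subspace_add subspace_scale subspace_cd_carrier cd_pair_in_carrier x)
  have one: "cd_conj (Suc m) (cd_one (Suc m)) = cd_one (Suc m)"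
    "cd_mult (Suc m) x (cd_one (Suc m)) = x"
    using x by (simp_all only: cd_conj_one cd_mult_one)
  have "cd_inner (Suc m) x (r *\<^sub>R cd_one (Suc m) + s *\<^sub>R cd_i (Suc m)) = cd_Re (Suc m) ?y"
    unfolding cd_inner_def cd_conj_linear cd_mult_linear one cd_mult_conj_i[OF x] ..
  also have "\<dots> = (r * Poly_Mapping.lookup x 0 + s * Poly_Mapping.lookup x (2 ^ m)) *\<^sub>R cd_one (Suc m)"
    unfolding cd_Re_eq[OF y] by (simp add: lookup_add cd_pair.rep_eq cd_snd.rep_eq)
  finally have eq: "cd_inner (Suc m) x (r *\<^sub>R cd_one (Suc m) + s *\<^sub>R cd_i (Suc m)) =
    (r * Poly_Mapping.lookup x 0 + s * Poly_Mapping.lookup x (2 ^ m)) *\<^sub>R cd_one (Suc m)" .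
  have "cd_one (Suc m) \<noteq> 0"
    unfolding cd_one_eq by simp
  then show ?thesis
    unfolding cd_orthogonal_def eq by simp
qed

lemma cd_proj_C_unique:
  assumes n: "n \<ge> 1" and x: "x \<in> cd_carrier n"
  shows "\<exists>!p. p \<in> cd_C n \<and> (\<forall>c\<in>cd_C n. cd_orthogonal n (x - p) c)"
proof -
  obtain m where m: "n = Suc m"
    using n by (cases n) auto
  let ?x0 = "Poly_Mapping.lookup x 0" and ?x1 = "Poly_Mapping.lookup x (2 ^ m)"
  have lk: "Poly_Mapping.lookup (cd_one n) 0 = 1" "Poly_Mapping.lookup (cd_one n) (2 ^ m) = 0"
    "Poly_Mapping.lookup (cd_i n) 0 = 0" "Poly_Mapping.lookup (cd_i n) (2 ^ m) = 1"
    unfolding m cd_i_def cd_one_eq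
    by (simp_all add: cd_pair.rep_eq lookup_single del: single_one)
  have "(\<forall>c\<in>cd_C n. cd_orthogonal n (x - (r *\<^sub>R cd_one n + s *\<^sub>R cd_i n)) c) \<longleftrightarrow>
        r = ?x0 \<and> s = ?x1" for r s
  proof -
    have "r *\<^sub>R cd_one n + s *\<^sub>R cd_i n \<in> cd_carrier n"
      using n by (intro subspace_add subspace_scale subspace_cd_carrier cd_one_in_carrier
          cd_i_in_carrier)
    then have d: "x - (r *\<^sub>R cd_one n + s *\<^sub>R cd_i n) \<in> cd_carrier (Suc m)"
      using x subspace_diff[OF subspace_cd_carrier] m by blast
    let ?z = "x - (r *\<^sub>R cd_one n + s *\<^sub>R cd_i n)"
    have z: "cd_orthogonal n ?z (t *\<^sub>R cd_one n + u *\<^sub>R cd_i n) \<longleftrightarrow>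
      t * (?x0 - r) + u * (?x1 - s) = 0" for t u
      using cd_orthogonal_C[OF d, of t u] lk
      by (simp add: m[symmetric] lookup_minus lookup_add)
    have "(\<forall>c\<in>cd_C n. cd_orthogonal n ?z c) \<longleftrightarrow>
      (\<forall>t u. cd_orthogonal n ?z (t *\<^sub>R cd_one n + u *\<^sub>R cd_i n))"
      unfolding Ball_def cd_C_iff by blast
    also have "\<dots> \<longleftrightarrow> (\<forall>t u. t * (?x0 - r) + u * (?x1 - s) = 0)"
      by (simp only: z)
    also have "\<dots> \<longleftrightarrow> r = ?x0 \<and> s = ?x1"
    proof
      assume *: "\<forall>t u. t * (?x0 - r) + u * (?x1 - s) = 0"
      show "r = ?x0 \<and> s = ?x1"
        using *[rule_format, of 1 0] *[rule_format, of 0 1] by simp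
    qed simp
    finally show ?thesis .
  qed
  then show ?thesis
    by (intro ex1I[of _ "?x0 *\<^sub>R cd_one n + ?x1 *\<^sub>R cd_i n"]) (auto simp: cd_C_iff)
qed

end

theory Submission
  imports Defs
begin

text \<open>
  Left multiplication by \<open>a \<in> \<complex>\<^sub>n\<^sup>\<perp>\<close> is conjugate-linear over \<open>\<complex>\<^sub>n\<close> and skew for the real inner
  product.  Every element of \<open>A\<^bsub>n+1\<^esub>\<close> is a multiple of some \<open>{x, y}\<close> plus an element \<open>(c, d)\<close> of
  \<open>\<complex>\<^sub>n \<times> \<complex>\<^sub>n\<close>; expanding \<open>{a, b} ({x, y} + (c, d)) = 0\<close> and separating the components in \<open>\<complex>\<^sub>n\<close> and in
  \<open>\<complex>\<^sub>n\<^sup>\<perp>\<close> gives equations in which \<open>c, d\<close> enter through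
  \<open>\<alpha> = Re c + i Re d\<close> and \<open>\<beta> = Im d + i Im c\<close>, and \<open>\<alpha> = 0\<close> is forced.  What remains says that,
  modulo \<open>\<complex>\<^sub>n\<close>, \<open>2 a x = \<beta> b\<close> and \<open>2 b y = - \<beta>\<^sup>* a\<close>, together with two complex scalar equations.

  A skew map has image \<open>(ker)\<^sup>\<perp>\<close>, so a solution with \<open>\<beta> \<noteq> 0\<close> exists exactly on the \<open>D\<close>-locus, and
  then for every \<open>\<beta>\<close>: this accounts for two real dimensions.  For \<open>\<beta> = 0\<close> one has
  \<open>x = \<gamma> a + x'\<close> and \<open>y = \<delta> b + y'\<close> with \<open>x' \<in> Ann a\<close>, \<open>y' \<in> Ann b\<close>; the first scalar equation
  determines \<open>\<delta>\<close> from \<open>\<gamma>\<close>, so that \<open>\<gamma>\<close> adds two real dimensions, and the second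
  is vacuous on the \<open>D\<close>-locus and onto \<open>\<complex>\<close> off it, where it removes them again.
\<close>

subsection \<open>Dimensions of finite-dimensional subspaces\<close>

text \<open>Infinite-dimensional subspaces have \<open>dim\<close> equal to 0 by convention, hence
  the hypothesis that \<open>V\<close> lies in a finite span. A basis \<open>K\<close> of the kernel
  extends to a basis \<open>E\<close> of \<open>V\<close>, and \<open>f\<close> is injective on the
  span of \<open>E - K\<close>.\<close>

lemma rank_nullity:
  fixes f :: "'a::real_vector \<Rightarrow> 'b::real_vector"
  assumes f: "linear f" and V: "subspace V" and B: "finite B" "V \<subseteq> span B"
  shows "dim V = dim (f ` V) + dim {x \<in> V. f x = 0}"
proof -
  let ?N = "{x \<in> V. f x = 0}"
  obtain K where K: "K \<subseteq> ?N" "independent K" "?N \<subseteq> span K"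
    using maximal_independent_subset[of ?N] by metis
  obtain E where E: "K \<subseteq> E" "E \<subseteq> V" "independent E" "V \<subseteq> span E"
    using maximal_independent_subset_extend[of K V] K(1,2) by blast
  have finE: "finite E"
    using independent_span_bound[OF B(1) E(3)] E(2) B(2) by auto
  have spE: "span E = V"
    using E V by (simp add: span_subspace)
  \<comment> \<open>\<open>g\<close> is the projection onto \<open>span K\<close> along
    \<open>span (E - K)\<close>; it shows that these two spans meet only in 0.\<close>
  obtain g :: "'a \<Rightarrow> 'a" where g: "linear g" "\<forall>x\<in>E. g x = (if x \<in> K then x else 0)"
    using linear_independent_extend[OF E(3), of "\<lambda>x. if x \<in> K then x else 0"] by blast
  have gK: "g x = x" if "x \<in> span K" for x
    by (rule linear_eq_on[OF g(1) linear_id[unfolded id_def] that]) (use g(2) E(1) in auto)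
  have gEK: "g x = 0" if "x \<in> span (E - K)" for x
    by (rule linear_eq_on[OF g(1) linear_zero that]) (use g(2) in auto)
  have sub: "span (E - K) \<subseteq> V"
    using spE span_mono[of "E - K" E] by auto
  have "x = 0" if "x \<in> span (E - K)" "f x = 0" for x
  proof -
    have "x \<in> span K"
      using that sub K(3) by auto
    then show ?thesis
      using gK gEK that(1) by metis
  qed
  then have inj: "inj_on f (span (E - K))"
    using linear_inj_on_iff_eq_0[OF f subspace_span] by blast
  have indEK: "independent (E - K)"
    using E(3) independent_mono by blast
  have ind: "independent (f ` (E - K))"
    using linear_independent_injective_image[OF f indEK inj] .
  have "f ` V = span (f ` E)"
    using linear_span_image[OF f, of E] spE by simp
  also have "f ` E \<subseteq> insert 0 (f ` (E - K))"
    using K(1) by auto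
  then have "span (f ` E) = span (f ` (E - K))"
    by (metis Diff_subset image_mono span_insert_0 span_mono subset_antisym)
  finally have "dim (f ` V) = card (f ` (E - K))"
    using ind by (simp add: dim_eq_card_independent)
  also have "\<dots> = card E - card K"
    using inj span_superset[of "E - K"] E(1) finE
    by (subst card_image) (auto intro: inj_on_subset simp: card_Diff_subset finite_subset)
  moreover have "dim ?N = card K"
    using K by (intro dim_unique) auto
  moreover have "dim V = card E"
    using E by (intro dim_unique) auto
  moreover have "card K \<le> card E"
    using E(1) finE by (rule card_mono[rotated])
  ultimately show ?thesis by simp
qed

lemma dim_inj_image:
  fixes f :: "'a::real_vector \<Rightarrow> 'b::real_vector"
  assumes "linear f" "subspace V" "finite B" "V \<subseteq> span B"
    and "\<And>x. x \<in> V \<Longrightarrow> f x = 0 \<Longrightarrow> x = 0"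
  shows "dim (f ` V) = dim V"
proof -
  have "{x \<in> V. f x = 0} = {0}"
    using assms linear_0[OF assms(1)] subspace_0[OF assms(2)] by auto
  then show ?thesis
    using rank_nullity[OF assms(1-4)] dim_eq_card_independent[OF independent_empty, where 'a='a]
      dim_span[of "{}::'a set"] by simp
qed

lemma subset_span_Times:
  fixes V A :: "'a::real_vector set" and W B :: "'b::real_vector set"
  assumes "V \<subseteq> span A" "W \<subseteq> span B"
  shows "V \<times> W \<subseteq> span ((\<lambda>x. (x, 0)) ` A \<union> (\<lambda>y. (0, y)) ` B)"
proof
  fix p assume p: "p \<in> V \<times> W"
  have l: "linear (\<lambda>x::'a. (x, 0::'b))" "linear (\<lambda>y::'b. (0::'a, y))"
    by (auto intro!: linearI)
  have "(fst p, 0::'b) \<in> span ((\<lambda>x. (x, 0)) ` A)" "(0::'a, snd p) \<in> span ((\<lambda>y. (0, y)) ` B)"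
    unfolding linear_span_image[OF l(1)] linear_span_image[OF l(2)] using p assms by auto
  then have "(fst p, 0) + (0, snd p) \<in> span ((\<lambda>x. (x, 0)) ` A \<union> (\<lambda>y. (0, y)) ` B)"
    unfolding span_Un by blast
  then show "p \<in> span ((\<lambda>x. (x, 0)) ` A \<union> (\<lambda>y. (0, y)) ` B)" by simp
qed

lemma cd_carrier_subset_span:
  "cd_carrier n \<subseteq> span ((\<lambda>k. Poly_Mapping.single k 1) ` {..<2 ^ n})"
proof
  fix x :: cd assume x: "x \<in> cd_carrier n"
  have "x = (\<Sum>k<2 ^ n. Poly_Mapping.lookup x k *\<^sub>R Poly_Mapping.single k 1)"
  proof (rule poly_mapping_eqI)
    fix j
    have "Poly_Mapping.lookup (\<Sum>k<2 ^ n. Poly_Mapping.lookup x k *\<^sub>R Poly_Mapping.single k 1) j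
        = (\<Sum>k<2 ^ n. if k = j then Poly_Mapping.lookup x k else 0)"
      unfolding lookup_sum by (rule sum.cong) (auto simp: lookup_single when_def)
    also have "\<dots> = Poly_Mapping.lookup x j"
      using x by (simp add: sum.delta cd_carrier_iff)
    finally show "Poly_Mapping.lookup x j =
      Poly_Mapping.lookup (\<Sum>k<2 ^ n. Poly_Mapping.lookup x k *\<^sub>R Poly_Mapping.single k 1) j"
      by simp
  qed
  also have "\<dots> \<in> span ((\<lambda>k. Poly_Mapping.single k 1) ` {..<2 ^ n})"
    by (intro span_sum span_scale span_base) auto
  finally show "x \<in> span ((\<lambda>k. Poly_Mapping.single k 1) ` {..<2 ^ n})" .
qed

subsection \<open>The real inner product\<close>

definition cd_ip :: "nat \<Rightarrow> cd \<Rightarrow> cd \<Rightarrow> real" where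
  "cd_ip n x y = (\<Sum>k<2 ^ n. Poly_Mapping.lookup x k * Poly_Mapping.lookup y k)"

lemma cd_ip_commute: "cd_ip n x y = cd_ip n y x"
  unfolding cd_ip_def by (rule sum.cong) auto

lemma cd_ip_linear_left:
  "cd_ip n (x + x') y = cd_ip n x y + cd_ip n x' y"
  "cd_ip n (r *\<^sub>R x) y = r * cd_ip n x y"
  unfolding cd_ip_def
  by (simp_all only: lookup_add lookup_scaleR distrib_right sum.distrib sum_distrib_left
      real_scaleR_def mult.assoc)

lemma cd_ip_linear [simp]:
  "cd_ip n (x + x') y = cd_ip n x y + cd_ip n x' y"
  "cd_ip n x (y + y') = cd_ip n x y + cd_ip n x y'"
  "cd_ip n (r *\<^sub>R x) y = r * cd_ip n x y"
  "cd_ip n x (r *\<^sub>R y) = r * cd_ip n x y"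
  "cd_ip n (- x) y = - cd_ip n x y"
  "cd_ip n x (- y) = - cd_ip n x y"
  "cd_ip n (x - x') y = cd_ip n x y - cd_ip n x' y"
  "cd_ip n x (y - y') = cd_ip n x y - cd_ip n x y'"
  "cd_ip n 0 y = 0"
  "cd_ip n x 0 = 0"
proof -
  show 1: "cd_ip n (x + x') y = cd_ip n x y + cd_ip n x' y" for x x' y
    by (rule cd_ip_linear_left)
  show 2: "cd_ip n x (y + y') = cd_ip n x y + cd_ip n x y'" for x y y'
    using cd_ip_linear_left(1)[of n y y' x] by (simp only: cd_ip_commute[of n x])
  show 3: "cd_ip n (r *\<^sub>R x) y = r * cd_ip n x y" for r x y
    by (rule cd_ip_linear_left)
  show 4: "cd_ip n x (r *\<^sub>R y) = r * cd_ip n x y" for r x y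
    using cd_ip_linear_left(2)[of n r y x] by (simp only: cd_ip_commute[of n x])
  show 5: "cd_ip n (- x) y = - cd_ip n x y" for x y
    using 3[of "- 1" x y] by simp
  show 6: "cd_ip n x (- y) = - cd_ip n x y" for x y
    using 4[of x "- 1" y] by simp
  show "cd_ip n (x - x') y = cd_ip n x y - cd_ip n x' y"
    using 1[of x "- x'" y] 5 by simp
  show "cd_ip n x (y - y') = cd_ip n x y - cd_ip n x y'"
    using 2[of x y "- y'"] 6 by simp
  show "cd_ip n 0 y = 0" "cd_ip n x 0 = 0"
    using 3[of 0 0 y] 4[of x 0 0] by simp_all
qed

lemma cd_ip_self_nonneg: "cd_ip n x x \<ge> 0"
  unfolding cd_ip_def by (rule sum_nonneg) simp

lemma cd_ip_self_eq_0_iff: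
  assumes "x \<in> cd_carrier n"
  shows "cd_ip n x x = 0 \<longleftrightarrow> x = 0"
proof
  assume "cd_ip n x x = 0"
  then have *: "Poly_Mapping.lookup x k = 0" if "k < 2 ^ n" for k
    using sum_nonneg_eq_0_iff[of "{..<2 ^ n}" "\<lambda>k. Poly_Mapping.lookup x k * Poly_Mapping.lookup x k"] that
    unfolding cd_ip_def by simp
  show "x = 0"
  proof (rule poly_mapping_eqI)
    show "Poly_Mapping.lookup x k = Poly_Mapping.lookup 0 k" for k
      using * assms by (cases "k < 2 ^ n") (auto simp: cd_carrier_iff)
  qed
qed simp

lemma cd_ip_Suc:
  "cd_ip (Suc n) x y = cd_ip n (cd_fst n x) (cd_fst n y) + cd_ip n (cd_snd n x) (cd_snd n y)"
proof -
  let ?f = "\<lambda>k. Poly_Mapping.lookup x k * Poly_Mapping.lookup y k"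
  have "cd_ip (Suc n) x y = sum ?f ({..<2 ^ n} \<union> {2 ^ n..<2 ^ n + 2 ^ n})"
    unfolding cd_ip_def by (rule sum.cong) auto
  also have "\<dots> = sum ?f {..<2 ^ n} + sum ?f {2 ^ n..<2 ^ n + 2 ^ n}"
    by (rule sum.union_disjoint) auto
  also have "sum ?f {2 ^ n..<2 ^ n + 2 ^ n} =
      (\<Sum>k<2 ^ n. Poly_Mapping.lookup x (k + 2 ^ n) * Poly_Mapping.lookup y (k + 2 ^ n))"
    using sum.shift_bounds_nat_ivl[of ?f 0 "2 ^ n" "2 ^ n"] by (simp only: atLeast0LessThan add_0)
  finally show ?thesis
    by (simp add: cd_ip_def cd_fst.rep_eq cd_snd.rep_eq)
qed

section \<open>Conjugation and the adjoint of left multiplication\<close>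

lemmas cd_carrier_add = subspace_add[OF subspace_cd_carrier]
  and cd_carrier_diff = subspace_diff[OF subspace_cd_carrier]
  and cd_carrier_neg = subspace_neg[OF subspace_cd_carrier]
  and cd_carrier_scale = subspace_scale[OF subspace_cd_carrier]
  and cd_carrier_0 = subspace_0[OF subspace_cd_carrier]

lemma cd_mult_neg [simp]: "cd_mult n (- x) y = - cd_mult n x y" "cd_mult n x (- y) = - cd_mult n x y"
  using cd_mult_linear(3)[of n "- 1" x y] cd_mult_linear(4)[of n x "- 1" y] by simp_all

lemma cd_mult_diff:
  "cd_mult n (x - x') y = cd_mult n x y - cd_mult n x' y"
  "cd_mult n x (y - y') = cd_mult n x y - cd_mult n x y'"
  using cd_mult_linear(1)[of n x "- x'" y] cd_mult_linear(2)[of n x y "- y'"] by simp_all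

lemma cd_conj_diff: "cd_conj n (x - y) = cd_conj n x - cd_conj n y"
  using cd_conj_linear(1)[of n x "- y"] by (simp add: cd_conj_neg)

lemma cd_conj_conj: "x \<in> cd_carrier n \<Longrightarrow> cd_conj n (cd_conj n x) = x"
  by (rule poly_mapping_eqI) (simp add: lookup_cd_conj cd_conj_in_carrier)

lemma cd_ip_conj:
  "x \<in> cd_carrier n \<Longrightarrow> y \<in> cd_carrier n \<Longrightarrow> cd_ip n (cd_conj n x) (cd_conj n y) = cd_ip n x y"
  unfolding cd_ip_def by (rule sum.cong) (auto simp: lookup_cd_conj)

lemmas cd_carrier_intros = cd_carrier_add cd_carrier_diff cd_carrier_neg cd_carrier_scale
  cd_carrier_0 cd_mult_in_carrier cd_conj_in_carrier cd_fst_in_carrier cd_snd_in_carrier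

lemma cd_pair_minus: "cd_pair n (- a) (- b) = - cd_pair n a b"
  using cd_pair_linear(2)[of n "-1" a b] by simp

lemma cd_conj_mult:
  "x \<in> cd_carrier n \<Longrightarrow> y \<in> cd_carrier n \<Longrightarrow>
    cd_conj n (cd_mult n x y) = cd_mult n (cd_conj n y) (cd_conj n x)"
proof (induction n arbitrary: x y)
  case 0
  then show ?case by (simp add: mult.commute)
next
  case (Suc n)
  note c = cd_fst_in_carrier[of n x] cd_fst_in_carrier[of n y]
    cd_snd_in_carrier[OF Suc.prems(1)] cd_snd_in_carrier[OF Suc.prems(2)]
  show ?case
    by (simp add: Let_def cd_fst_pair cd_snd_pair c cd_carrier_intros cd_conj_diff cd_conj_linear
        cd_conj_neg Suc.IH cd_conj_conj)
qed

text \<open>The two equalities go through the induction together: the first half of (a, b)(c, d)^*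
  is a c^* + d^* b, which involves both kinds of product.\<close>

lemma lookup_mult_conj_0:
  "x \<in> cd_carrier n \<Longrightarrow> y \<in> cd_carrier n \<Longrightarrow>
    Poly_Mapping.lookup (cd_mult n x (cd_conj n y)) 0 = cd_ip n x y \<and>
    Poly_Mapping.lookup (cd_mult n (cd_conj n x) y) 0 = cd_ip n x y"
proof (induction n arbitrary: x y)
  case 0
  then show ?case by (simp add: cd_ip_def lookup_single)
next
  case (Suc n)
  note c = cd_fst_in_carrier[of n x] cd_fst_in_carrier[of n y]
    cd_snd_in_carrier[OF Suc.prems(1)] cd_snd_in_carrier[OF Suc.prems(2)]
  show ?case
    by (simp add: Let_def cd_fst_pair cd_snd_pair c cd_carrier_intros cd_conj_neg Suc.IH
        cd_pair.rep_eq lookup_add lookup_minus cd_ip_Suc cd_ip_commute)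
qed

text \<open>By induction, since in halves a left multiplication consists of left and right
  multiplications one level below. For a in \<open>P\<close>, where a^* = -a, this is the skewness
  used throughout.\<close>

lemma cd_ip_mult_left:
  "a \<in> cd_carrier n \<Longrightarrow> x \<in> cd_carrier n \<Longrightarrow> y \<in> cd_carrier n \<Longrightarrow>
    cd_ip n (cd_mult n a x) y = cd_ip n x (cd_mult n (cd_conj n a) y)"
proof (induction n arbitrary: a x y)
  case 0
  then show ?case by (simp add: cd_ip_def lookup_single)
next
  case (Suc n)
  let ?a = "cd_fst n a" and ?a' = "cd_snd n a" and ?x = "cd_fst n x" and ?x' = "cd_snd n x"
    and ?y = "cd_fst n y" and ?y' = "cd_snd n y"
  have c: "?a \<in> cd_carrier n" "?a' \<in> cd_carrier n" "?x \<in> cd_carrier n" "?x' \<in> cd_carrier n"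
    "?y \<in> cd_carrier n" "?y' \<in> cd_carrier n"
    using Suc.prems by (auto intro: cd_fst_in_carrier cd_snd_in_carrier)
  \<comment> \<open>The adjoint of right multiplication follows from that of left multiplication,
    because conjugation is an isometry that reverses products.\<close>
  have right: "cd_ip n (cd_mult n u v) z = cd_ip n u (cd_mult n z (cd_conj n v))"
    if "u \<in> cd_carrier n" "v \<in> cd_carrier n" "z \<in> cd_carrier n" for u v z
  proof -
    have "cd_ip n (cd_mult n u v) z = cd_ip n (cd_conj n (cd_mult n u v)) (cd_conj n z)"
      using that by (simp add: cd_ip_conj cd_carrier_intros)
    also have "\<dots> = cd_ip n (cd_conj n u) (cd_mult n v (cd_conj n z))"
      using that by (simp add: cd_conj_mult Suc.IH cd_carrier_intros cd_conj_conj)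
    also have "\<dots> = cd_ip n u (cd_conj n (cd_mult n v (cd_conj n z)))"
      using that cd_ip_conj[of u n "cd_conj n (cd_mult n v (cd_conj n z))"]
      by (simp add: cd_carrier_intros cd_conj_conj)
    also have "\<dots> = cd_ip n u (cd_mult n z (cd_conj n v))"
      using that by (simp add: cd_conj_mult cd_carrier_intros cd_conj_conj)
    finally show ?thesis .
  qed
  have 1: "cd_ip n (cd_mult n ?a' (cd_conj n ?x)) ?y' = cd_ip n ?x (cd_mult n (cd_conj n ?y') ?a')"
  proof -
    have "cd_ip n (cd_mult n ?a' (cd_conj n ?x)) ?y' = cd_ip n (cd_conj n ?x) (cd_mult n (cd_conj n ?a') ?y')"
      using c by (simp add: Suc.IH cd_carrier_intros)
    also have "\<dots> = cd_ip n ?x (cd_conj n (cd_mult n (cd_conj n ?a') ?y'))"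
      using c cd_ip_conj[of ?x n "cd_conj n (cd_mult n (cd_conj n ?a') ?y')"]
      by (simp add: cd_carrier_intros cd_conj_conj)
    finally show ?thesis
      using c by (simp add: cd_conj_mult cd_carrier_intros cd_conj_conj)
  qed
  have 2: "cd_ip n (cd_mult n (cd_conj n ?x') ?a') ?y = cd_ip n ?x' (cd_mult n ?a' (cd_conj n ?y))"
  proof -
    have "cd_ip n (cd_mult n (cd_conj n ?x') ?a') ?y = cd_ip n (cd_conj n ?x') (cd_mult n ?y (cd_conj n ?a'))"
      using c by (simp add: right cd_carrier_intros)
    also have "\<dots> = cd_ip n ?x' (cd_conj n (cd_mult n ?y (cd_conj n ?a')))"
      using c cd_ip_conj[of ?x' n "cd_conj n (cd_mult n ?y (cd_conj n ?a'))"]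
      by (simp add: cd_carrier_intros cd_conj_conj)
    finally show ?thesis
      using c by (simp add: cd_conj_mult cd_carrier_intros cd_conj_conj)
  qed
  have 3: "cd_ip n (cd_mult n ?a ?x) ?y = cd_ip n ?x (cd_mult n (cd_conj n ?a) ?y)"
    using c by (simp add: Suc.IH)
  have 4: "cd_ip n (cd_mult n ?x' ?a) ?y' = cd_ip n ?x' (cd_mult n ?y' (cd_conj n ?a))"
    using c by (simp add: right)
  show ?case
    by (simp add: Let_def cd_ip_Suc cd_fst_pair cd_snd_pair c cd_carrier_intros cd_conj_neg
        1 2 3 4)
qed

section \<open>Orthogonal projection and the image of a skew map\<close>

lemma cd_ip_orthogonal_projection:
  assumes "finite B" "B \<subseteq> cd_carrier n" "v \<in> cd_carrier n"
  shows "\<exists>p\<in>span B. \<forall>u\<in>span B. cd_ip n (v - p) u = 0"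
  using assms
proof (induction B arbitrary: v rule: finite_induct)
  case empty
  then show ?case by simp
next
  case (insert b B)
  have sub: "span B \<subseteq> cd_carrier n"
    using insert.prems by (intro span_minimal subspace_cd_carrier) auto
  have b: "b \<in> cd_carrier n"
    using insert.prems by simp
  obtain p where p: "p \<in> span B" "\<And>u. u \<in> span B \<Longrightarrow> cd_ip n (v - p) u = 0"
    using insert.IH[of v] insert.prems by auto
  obtain q where q: "q \<in> span B" "\<And>u. u \<in> span B \<Longrightarrow> cd_ip n (b - q) u = 0"
    using insert.IH[OF _ b] insert.prems by auto
  let ?e = "b - q"
  have e: "?e \<in> cd_carrier n"
    using b q(1) sub by (intro cd_carrier_diff) auto
  define r where "r = cd_ip n (v - p) ?e / cd_ip n ?e ?e"
  \<comment> \<open>\<open>?e\<close> is the part of \<open>b\<close> orthogonal to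
    \<open>span B\<close>. If it vanishes, \<open>r\<close> is a division by zero, but both sides
    are then 0.\<close>
  have re: "r * cd_ip n ?e ?e = cd_ip n (v - p) ?e"
  proof (cases "?e = 0")
    case True
    then show ?thesis by (simp del: right_minus_eq)
  next
    case False
    then show ?thesis
      using cd_ip_self_eq_0_iff[OF e] by (simp add: r_def del: cd_ip_linear)
  qed
  have sp: "span B \<subseteq> span (insert b B)"
    by (rule span_mono) auto
  have "p + r *\<^sub>R ?e \<in> span (insert b B)"
    using subsetD[OF sp p(1)] subsetD[OF sp q(1)] by (intro span_add span_scale span_diff) (auto intro: span_base)
  moreover have "cd_ip n (v - (p + r *\<^sub>R ?e)) u = 0" if u_in: "u \<in> span (insert b B)" for u
  proof -
    obtain k where k: "u - k *\<^sub>R b \<in> span B"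
      using u_in unfolding span_breakdown_eq by blast
    define t where "t = (u - k *\<^sub>R b) + k *\<^sub>R q"
    have t: "t \<in> span B"
      unfolding t_def using k q(1) by (intro span_add span_scale)
    have u: "u = t + k *\<^sub>R ?e"
      by (simp add: t_def algebra_simps)
    have "cd_ip n (v - (p + r *\<^sub>R ?e)) u = cd_ip n ((v - p) - r *\<^sub>R ?e) (t + k *\<^sub>R ?e)"
      unfolding u by (simp only: diff_diff_eq)
    also have "\<dots> = (cd_ip n (v - p) t - r * cd_ip n ?e t) +
        k * (cd_ip n (v - p) ?e - r * cd_ip n ?e ?e)"
      by (simp add: algebra_simps)
    also have "\<dots> = 0"
      using p(2)[OF t] q(2)[OF t] re by (simp del: cd_ip_linear)
    finally show ?thesis .
  qed
  ultimately show ?case by blast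
qed

text \<open>Let q = v - p with p the projection of v to the image of T. Then <Tq, Tq> = -<q, TTq> =
  0, so q is in the kernel and orthogonal to v; it is also orthogonal to p, hence q = 0.\<close>

lemma skew_image:
  assumes V: "subspace V" "V \<subseteq> cd_carrier n" and T: "linear T" "\<And>x. x \<in> V \<Longrightarrow> T x \<in> V"
    and skew: "\<And>x y. x \<in> V \<Longrightarrow> y \<in> V \<Longrightarrow> cd_ip n (T x) y = - cd_ip n x (T y)"
    and v: "v \<in> V" "\<And>u. u \<in> V \<Longrightarrow> T u = 0 \<Longrightarrow> cd_ip n v u = 0"
  obtains x where "x \<in> V" "T x = v"
proof -
  obtain B where B: "B \<subseteq> T ` V" "independent B" "T ` V \<subseteq> span B"
    using maximal_independent_subset[of "T ` V"] by metis
  have sV: "subspace (T ` V)"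
    using linear_subspace_image[OF T(1) V(1)] .
  have BV: "B \<subseteq> cd_carrier n"
    using B(1) T(2) V(2) by blast
  have "finite B"
    using independent_span_bound[OF _ B(2) subset_trans[OF BV cd_carrier_subset_span]] by simp
  moreover have vc: "v \<in> cd_carrier n"
    using v V by auto
  ultimately obtain p where p: "p \<in> span B" "\<And>u. u \<in> span B \<Longrightarrow> cd_ip n (v - p) u = 0"
    using cd_ip_orthogonal_projection[OF _ BV, of v] by blast
  have "span B = T ` V"
    using B sV by (simp add: span_minimal subset_antisym)
  then obtain x where x: "x \<in> V" "p = T x"
    using p(1) by auto
  let ?q = "v - p"
  have q: "?q \<in> V" "?q \<in> cd_carrier n"
    using v(1) x T(2) V subspace_diff[OF V(1)] by auto
  have TT: "T (T ?q) \<in> span B" "T ?q \<in> V" "T ?q \<in> cd_carrier n"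
    using T(2) q B(3) V(2) by auto
  have "cd_ip n (T ?q) (T ?q) = - cd_ip n ?q (T (T ?q))"
    using skew[of ?q "T ?q"] q TT by blast
  then have "cd_ip n (T ?q) (T ?q) = 0"
    using p(2)[OF TT(1)] by (simp del: cd_ip_linear)
  then have "T ?q = 0"
    using cd_ip_self_eq_0_iff[OF TT(3)] by blast
  then have "cd_ip n v ?q = 0"
    using v(2) q(1) by blast
  moreover have "cd_ip n p ?q = 0"
    using p(2)[OF p(1)] cd_ip_commute[of n p ?q] by (simp del: cd_ip_linear)
  ultimately have "cd_ip n ?q ?q = 0"
    using cd_ip_linear(7)[of n v p ?q] by linarith
  then have "?q = 0"
    using cd_ip_self_eq_0_iff[OF q(2)] by blast
  then show ?thesis
    using that x by simp
qed

text \<open>The library product is convolution, but a numeral factor only scales the coordinates.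
  Needed when identities between elements are checked coordinatewise.\<close>

lemma lookup_numeral_mult: "Poly_Mapping.lookup (numeral k * x) j = numeral k * Poly_Mapping.lookup x j"
  for x :: cd
proof -
  have "Poly_Mapping.lookup (of_nat m * x) j = of_nat m * Poly_Mapping.lookup x j" for m
    by (induction m) (simp_all add: distrib_right lookup_add)
  from this[of "numeral k"] show ?thesis
    by simp
qed

lemma add_diff_eq_0_iff:
  fixes p q e f :: "'a::real_vector"
  assumes "2 *\<^sub>R e = p + q" "2 *\<^sub>R f = p - q"
  shows "p = 0 \<and> q = 0 \<longleftrightarrow> e = 0 \<and> f = 0"
proof
  assume "p = 0 \<and> q = 0"
  then show "e = 0 \<and> f = 0"
    using assms by simp
next
  assume "e = 0 \<and> f = 0"
  then have "p + q = 0" "p = q"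
    using assms by simp_all
  then have "2 *\<^sub>R q = 0"
    by (simp only: scaleR_2)
  then show "p = 0 \<and> q = 0"
    using \<open>p = q\<close> by simp
qed

lemma cd_conj_eq:
  assumes "x \<in> cd_carrier k"
  shows "cd_conj k x = (2 * Poly_Mapping.lookup x 0) *\<^sub>R cd_one k - x"
proof (rule poly_mapping_eqI)
  show "Poly_Mapping.lookup (cd_conj k x) j =
      Poly_Mapping.lookup ((2 * Poly_Mapping.lookup x 0) *\<^sub>R cd_one k - x) j" for j
    using assms by (simp add: lookup_cd_conj cd_one_eq lookup_minus lookup_single del: single_one)
qed

subsection \<open>The complex structure\<close>

locale cayley_dickson =
  fixes n :: nat
  assumes n_ge_1: "n \<ge> 1"
begin

abbreviation A :: "cd set" where "A \<equiv> cd_carrier n"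
abbreviation P :: "cd set" where "P \<equiv> cd_C_perp n"
abbreviation cd_prod (infixl "\<odot>" 70) where "x \<odot> y \<equiv> cd_mult n x y"
abbreviation ip where "ip \<equiv> cd_ip n"

definition J :: "cd \<Rightarrow> cd" where "J x = cd_i n \<odot> x"

text \<open>\<open>h\<close> reads off the component in \<open>\<complex>\<^sub>n\<close>, with \<open>\<complex>\<^sub>n\<close> identified with \<^typ>\<open>complex\<close>; \<open>emb\<close> is its section.\<close>

definition h :: "cd \<Rightarrow> complex" where
  "h x = Complex (Poly_Mapping.lookup x 0) (Poly_Mapping.lookup x (2 ^ (n - 1)))"

definition emb :: "complex \<Rightarrow> cd" where "emb \<alpha> = Re \<alpha> *\<^sub>R cd_one n + Im \<alpha> *\<^sub>R cd_i n"

text \<open>The complex scalar action, with \<open>J\<close> in the role of \<i>; it is left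
  multiplication by \<open>emb \<alpha>\<close>, see \<open>emb_mul\<close>.\<close>

definition sc :: "complex \<Rightarrow> cd \<Rightarrow> cd" where "sc \<alpha> x = Re \<alpha> *\<^sub>R x + Im \<alpha> *\<^sub>R J x"

definition w :: "cd \<Rightarrow> cd" where "w x = x - emb (h x)"

lemma J_linear [simp]:
  "J (x + y) = J x + J y" "J (x - y) = J x - J y" "J (- x) = - J x"
  "J (r *\<^sub>R x) = r *\<^sub>R J x" "J 0 = 0"
  by (simp_all add: J_def cd_mult_linear cd_mult_diff)

lemma h_linear [simp]:
  "h (x + y) = h x + h y" "h (x - y) = h x - h y" "h (- x) = - h x"
  "h (r *\<^sub>R x) = complex_of_real r * h x" "h 0 = 0"
  by (simp_all add: h_def lookup_add lookup_minus complex_eq_iff)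

lemma emb_linear [simp]:
  "emb (\<alpha> + \<beta>) = emb \<alpha> + emb \<beta>" "emb (\<alpha> - \<beta>) = emb \<alpha> - emb \<beta>" "emb (- \<alpha>) = - emb \<alpha>"
  "emb (complex_of_real r * \<alpha>) = r *\<^sub>R emb \<alpha>" "emb 0 = 0"
  by (simp_all add: emb_def algebra_simps)

lemma sc_linear [simp]:
  "sc \<alpha> (x + y) = sc \<alpha> x + sc \<alpha> y" "sc \<alpha> (x - y) = sc \<alpha> x - sc \<alpha> y" "sc \<alpha> (- x) = - sc \<alpha> x"
  "sc \<alpha> (r *\<^sub>R x) = r *\<^sub>R sc \<alpha> x" "sc \<alpha> 0 = 0"
  "sc (- \<alpha>) x = - sc \<alpha> x" "sc 0 x = 0"
  by (simp_all add: sc_def algebra_simps)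

lemma sc_add_left: "sc (\<alpha> + \<beta>) x = sc \<alpha> x + sc \<beta> x"
  and sc_scaleR_left: "sc (complex_of_real r * \<alpha>) x = r *\<^sub>R sc \<alpha> x"
  and sc_of_real [simp]: "sc (complex_of_real r) x = r *\<^sub>R x"
  by (simp_all add: sc_def algebra_simps)

lemma w_linear [simp]:
  "w (x + y) = w x + w y" "w (x - y) = w x - w y" "w (- x) = - w x"
  "w (r *\<^sub>R x) = r *\<^sub>R w x" "w 0 = 0"
  by (simp_all add: w_def algebra_simps)

lemma emb_h_add_w: "emb (h x) + w x = x"
  by (simp add: w_def)

lemma J_in_A [simp]: "x \<in> A \<Longrightarrow> J x \<in> A"
  using n_ge_1 by (simp add: J_def cd_mult_in_carrier cd_i_in_carrier)

lemma emb_in_A [simp]: "emb \<alpha> \<in> A"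
  using n_ge_1 by (simp add: emb_def cd_carrier_intros cd_one_in_carrier cd_i_in_carrier)

lemma A_closed [simp]:
  "x \<in> A \<Longrightarrow> y \<in> A \<Longrightarrow> x + y \<in> A" "x \<in> A \<Longrightarrow> y \<in> A \<Longrightarrow> x - y \<in> A" "x \<in> A \<Longrightarrow> - x \<in> A"
  "x \<in> A \<Longrightarrow> r *\<^sub>R x \<in> A" "0 \<in> A" "x \<in> A \<Longrightarrow> y \<in> A \<Longrightarrow> x \<odot> y \<in> A"
  by (simp_all add: cd_carrier_intros)

lemma sc_in_A [simp]: "x \<in> A \<Longrightarrow> sc \<alpha> x \<in> A"
  by (simp add: sc_def)

lemma w_in_A [simp]: "x \<in> A \<Longrightarrow> w x \<in> A"
  by (simp add: w_def)

lemma h_eq: "n = Suc m \<Longrightarrow> h x = Complex (Poly_Mapping.lookup x 0) (Poly_Mapping.lookup x (2 ^ m))"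
  unfolding h_def by simp

lemma P_iff: "x \<in> P \<longleftrightarrow> x \<in> A \<and> h x = 0"
proof -
  obtain m where m: "n = Suc m"
    using n_ge_1 by (cases n) auto
  have "(\<forall>c\<in>cd_C n. cd_orthogonal n x c) \<longleftrightarrow> h x = 0" if x: "x \<in> A"
  proof -
    have "(\<forall>c\<in>cd_C n. cd_orthogonal n x c) \<longleftrightarrow>
        (\<forall>r s. cd_orthogonal n x (r *\<^sub>R cd_one n + s *\<^sub>R cd_i n))"
      unfolding Ball_def cd_C_iff by blast
    also have "\<dots> \<longleftrightarrow> (\<forall>r s. r * Poly_Mapping.lookup x 0 + s * Poly_Mapping.lookup x (2 ^ m) = 0)"
      using cd_orthogonal_C[of x m] x unfolding m by simp
    also have "\<dots> \<longleftrightarrow> Poly_Mapping.lookup x 0 = 0 \<and> Poly_Mapping.lookup x (2 ^ m) = 0"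
    proof
      assume *: "\<forall>r s. r * Poly_Mapping.lookup x 0 + s * Poly_Mapping.lookup x (2 ^ m) = 0"
      show "Poly_Mapping.lookup x 0 = 0 \<and> Poly_Mapping.lookup x (2 ^ m) = 0"
        using *[rule_format, of 1 0] *[rule_format, of 0 1] by simp
    qed simp
    finally show ?thesis
      by (simp add: h_eq[OF m] complex_eq_iff)
  qed
  then show ?thesis
    unfolding cd_C_perp_def by blast
qed

lemma P_in_A [simp]: "x \<in> P \<Longrightarrow> x \<in> A"
  and h_P [simp]: "x \<in> P \<Longrightarrow> h x = 0"
  by (simp_all add: P_iff)

lemma P_closed [simp]:
  "x \<in> P \<Longrightarrow> y \<in> P \<Longrightarrow> x + y \<in> P" "x \<in> P \<Longrightarrow> y \<in> P \<Longrightarrow> x - y \<in> P" "x \<in> P \<Longrightarrow> - x \<in> P"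
  "x \<in> P \<Longrightarrow> r *\<^sub>R x \<in> P" "0 \<in> P"
  unfolding P_iff by simp_all

lemma mul_eq_pair:
  assumes "n = Suc m"
  shows "x \<odot> y = cd_pair m
    (cd_mult m (cd_fst m x) (cd_fst m y) - cd_mult m (cd_conj m (cd_snd m y)) (cd_snd m x))
    (cd_mult m (cd_snd m y) (cd_fst m x) + cd_mult m (cd_snd m x) (cd_conj m (cd_fst m y)))"
  by (simp add: assms Let_def)

lemma J_eq_pair:
  assumes m: "n = Suc m" and x: "x \<in> A"
  shows "J x = cd_pair m (- cd_conj m (cd_snd m x)) (cd_conj m (cd_fst m x))"
proof -
  have "cd_snd m x \<in> cd_carrier m"
    using x unfolding m by (rule cd_snd_in_carrier)
  then show ?thesis
    unfolding J_def mul_eq_pair[OF m]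
    by (simp add: cd_i_def m cd_fst_pair cd_snd_pair cd_mult_one cd_conj_in_carrier
        cd_fst_in_carrier cd_carrier_0)
qed

lemma obtain_components:
  obtains m where "n = Suc m" "\<And>x. x \<in> A \<Longrightarrow> cd_fst m x \<in> cd_carrier m"
    "\<And>x. x \<in> A \<Longrightarrow> cd_snd m x \<in> cd_carrier m"
proof (rule that)
  show n: "n = Suc (n - 1)"
    using n_ge_1 by simp
  show "cd_fst (n - 1) x \<in> cd_carrier (n - 1)" for x
    by (rule cd_fst_in_carrier)
  show "cd_snd (n - 1) x \<in> cd_carrier (n - 1)" if "x \<in> A" for x
    by (rule cd_snd_in_carrier) (use that n in simp)
qed

lemma J_J:
  assumes "x \<in> A"
  shows "J (J x) = - x"
proof -
  obtain m where m: "n = Suc m" "\<And>x. x \<in> A \<Longrightarrow> cd_fst m x \<in> cd_carrier m"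
    "\<And>x. x \<in> A \<Longrightarrow> cd_snd m x \<in> cd_carrier m"
    by (rule obtain_components) blast
  note c = m(2,3)[OF assms]
  show ?thesis
    unfolding J_eq_pair[OF m(1) J_in_A[OF assms]] unfolding J_eq_pair[OF m(1) assms]
    using c by (simp add: cd_fst_pair cd_snd_pair cd_carrier_intros(3,7) cd_conj_conj cd_conj_neg
        cd_pair_minus cd_pair_fst_snd)
qed

text \<open>The coordinates 0 and 2^m of \<open>a\<close> are the real parts of its two halves, so
  both halves are purely imaginary.\<close>

lemma P_components:
  assumes m: "n = Suc m" and a: "a \<in> P"
  shows "cd_conj m (cd_fst m a) = - cd_fst m a" "cd_conj m (cd_snd m a) = - cd_snd m a"
proof -
  have "Poly_Mapping.lookup a 0 = 0" "Poly_Mapping.lookup a (2 ^ m) = 0"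
    using h_P[OF a] by (simp_all add: h_eq[OF m] complex_eq_iff)
  moreover have "cd_snd m a \<in> cd_carrier m"
    using P_in_A[OF a] unfolding m by (rule cd_snd_in_carrier)
  ultimately show "cd_conj m (cd_fst m a) = - cd_fst m a" "cd_conj m (cd_snd m a) = - cd_snd m a"
    by (simp_all add: cd_conj_eq cd_fst_in_carrier cd_fst.rep_eq cd_snd.rep_eq)
qed

text \<open>In halves, \<open>J\<close> conjugates and exchanges up to sign
  (\<open>J_eq_pair\<close>). The two sides then differ only by conjugating the halves of
  \<open>a\<close>, which negates them.\<close>

lemma mul_J:
  assumes "a \<in> P" "b \<in> A"
  shows "a \<odot> J b = - J (a \<odot> b)"
proof -
  obtain m where m: "n = Suc m" "\<And>x. x \<in> A \<Longrightarrow> cd_fst m x \<in> cd_carrier m"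
    "\<And>x. x \<in> A \<Longrightarrow> cd_snd m x \<in> cd_carrier m"
    by (rule obtain_components) blast
  note c = m(2)[OF P_in_A[OF assms(1)]] m(3)[OF P_in_A[OF assms(1)]] m(2)[OF assms(2)] m(3)[OF assms(2)]
  have "a \<odot> b \<in> A"
    using assms by simp
  then show ?thesis
    using assms(2) by (simp add: J_eq_pair[OF m(1)] mul_eq_pair[OF m(1)] c cd_fst_pair cd_snd_pair
      cd_carrier_intros(1-7) cd_conj_conj cd_conj_neg cd_conj_diff cd_conj_linear cd_conj_mult
      P_components[OF m(1) assms(1)] cd_pair_minus[symmetric] algebra_simps minus_diff_commute)
qed

text \<open>\<open>2 *\<^sub>R emb (h z) - z\<close> is the reflection of \<open>z\<close> in C_n:
  right multiplication by \<i> is \<open>J\<close> on C_n and \<open>- J\<close> on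
  \<open>P\<close>.\<close>

lemma mul_i:
  assumes "z \<in> A"
  shows "z \<odot> cd_i n = J (2 *\<^sub>R emb (h z) - z)"
proof -
  obtain m where m: "n = Suc m" "\<And>x. x \<in> A \<Longrightarrow> cd_fst m x \<in> cd_carrier m"
    "\<And>x. x \<in> A \<Longrightarrow> cd_snd m x \<in> cd_carrier m"
    by (rule obtain_components) blast
  note c = m(2)[OF assms] m(3)[OF assms]
  have 1: "z \<odot> cd_i n = cd_pair m (- cd_snd m z) (cd_fst m z)"
    by (simp add: mul_eq_pair[OF m(1)] cd_i_def m(1) cd_fst_pair cd_snd_pair cd_carrier_0
        cd_conj_one cd_mult_one c)
  have 2: "emb \<alpha> = cd_pair m (Re \<alpha> *\<^sub>R cd_one m) (Im \<alpha> *\<^sub>R cd_one m)" for \<alpha>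
  proof -
    have "emb \<alpha> = Re \<alpha> *\<^sub>R cd_pair m (cd_one m) 0 + Im \<alpha> *\<^sub>R cd_pair m 0 (cd_one m)"
      unfolding emb_def by (simp add: m(1) cd_i_def)
    then show ?thesis
      unfolding cd_pair_linear(2)[symmetric] cd_pair_linear(1)[symmetric] by simp
  qed
  have one: "r *\<^sub>R cd_one m \<in> cd_carrier m" for r
    by (simp add: cd_carrier_scale cd_one_in_carrier)
  have h: "Re (h z) = Poly_Mapping.lookup (cd_fst m z) 0" "Im (h z) = Poly_Mapping.lookup (cd_snd m z) 0"
    by (simp_all add: h_eq[OF m(1)] cd_fst.rep_eq cd_snd.rep_eq)
  have j: "J z = cd_pair m (- cd_conj m (cd_snd m z)) (cd_conj m (cd_fst m z))"
    by (rule J_eq_pair[OF m(1) assms])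
  have je: "J (emb \<alpha>) = cd_pair m (- (Im \<alpha> *\<^sub>R cd_one m)) (Re \<alpha> *\<^sub>R cd_one m)" for \<alpha>
    using J_eq_pair[OF m(1) emb_in_A, of \<alpha>]
    by (simp add: 2 cd_fst_pair cd_snd_pair one cd_conj_linear cd_conj_one)
  have "J (2 *\<^sub>R emb (h z) - z) = 2 *\<^sub>R J (emb (h z)) + - J z"
    by simp
  also have "\<dots> = cd_pair m (2 *\<^sub>R - (Im (h z) *\<^sub>R cd_one m) + cd_conj m (cd_snd m z))
      (2 *\<^sub>R Re (h z) *\<^sub>R cd_one m - cd_conj m (cd_fst m z))"
    unfolding je j cd_pair_minus[symmetric] cd_pair_linear(2)[symmetric] cd_pair_linear(1)[symmetric]
    by simp
  also have "\<dots> = cd_pair m (- cd_snd m z) (cd_fst m z)"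
    unfolding h using c by (simp add: cd_conj_eq)
  finally show ?thesis
    using 1 by simp
qed

lemma h_J [simp]:
  assumes "x \<in> A"
  shows "h (J x) = \<i> * h x"
proof -
  obtain m where m: "n = Suc m" "\<And>x. x \<in> A \<Longrightarrow> cd_fst m x \<in> cd_carrier m"
    "\<And>x. x \<in> A \<Longrightarrow> cd_snd m x \<in> cd_carrier m"
    by (rule obtain_components) blast
  have "h (J x) = Complex (- Poly_Mapping.lookup (cd_snd m x) 0) (Poly_Mapping.lookup (cd_fst m x) 0)"
    using m(2,3)[OF assms] unfolding J_eq_pair[OF m(1) assms]
    by (simp add: h_eq[OF m(1)] cd_pair.rep_eq lookup_cd_conj)
  then show ?thesis
    by (simp add: h_eq[OF m(1)] cd_fst.rep_eq cd_snd.rep_eq complex_eq_iff)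
qed

lemma h_emb [simp]: "h (emb \<alpha>) = \<alpha>"
proof -
  have "Poly_Mapping.lookup (cd_i n) 0 = 0" "Poly_Mapping.lookup (cd_i n) (2 ^ (n - 1)) = 1"
    by (simp_all add: cd_i_def cd_pair.rep_eq cd_one_eq lookup_single del: single_one)
  then show ?thesis
    by (simp add: h_def emb_def complex_eq_iff lookup_add cd_one_eq lookup_single del: single_one)
qed

lemma J_emb: "J (emb \<alpha>) = emb (\<i> * \<alpha>)"
proof -
  have "J (cd_one n) = cd_i n"
    using n_ge_1 by (simp add: J_def cd_mult_one cd_i_in_carrier)
  moreover have "J (J (cd_one n)) = - cd_one n"
    by (rule J_J) (rule cd_one_in_carrier)
  ultimately show ?thesis
    by (simp add: emb_def)
qed

lemma w_J: "x \<in> A \<Longrightarrow> w (J x) = J (w x)"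
  by (simp add: w_def J_emb)

lemma h_sc [simp]: "x \<in> A \<Longrightarrow> h (sc \<alpha> x) = \<alpha> * h x"
  by (simp add: sc_def complex_eq_iff)

lemma J_in_P [simp]: "x \<in> P \<Longrightarrow> J x \<in> P"
  and sc_in_P [simp]: "x \<in> P \<Longrightarrow> sc \<alpha> x \<in> P"
  and w_in_P [simp]: "y \<in> A \<Longrightarrow> w y \<in> P"
  unfolding P_iff by (simp_all add: w_def)

lemma h_w [simp]: "h (w x) = 0"
  by (simp add: w_def)

lemma w_P [simp]: "x \<in> P \<Longrightarrow> w x = x"
  by (simp add: w_def)

lemma w_emb [simp]: "w (emb \<alpha>) = 0"
  by (simp add: w_def)

section \<open>Products of elements of C_n and of its orthogonal complement\<close>

lemma mul_sc: "a \<in> P \<Longrightarrow> b \<in> A \<Longrightarrow> a \<odot> sc \<alpha> b = sc (cnj \<alpha>) (a \<odot> b)"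
  by (simp add: sc_def cd_mult_linear mul_J)

lemma emb_mul: "x \<in> A \<Longrightarrow> emb \<alpha> \<odot> x = sc \<alpha> x"
  by (simp add: emb_def sc_def cd_mult_linear cd_mult_one J_def)

lemma mul_emb:
  assumes "u \<in> P"
  shows "u \<odot> emb \<alpha> = sc (cnj \<alpha>) u"
proof -
  have "u \<odot> cd_i n = - J u"
    using mul_i[of u] assms by simp
  then show ?thesis
    using assms by (simp add: emb_def sc_def cd_mult_linear cd_mult_one)
qed

lemma conj_P: "a \<in> P \<Longrightarrow> cd_conj n a = - a"
  using h_P[of a] by (simp add: cd_conj_eq h_def complex_eq_iff)

lemma conj_emb: "cd_conj n (emb \<alpha>) = emb (cnj \<alpha>)"
proof -
  have "Poly_Mapping.lookup (emb \<alpha>) 0 = Re (h (emb \<alpha>))"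
    by (simp only: h_def complex.sel)
  then show ?thesis
    by (simp add: cd_conj_eq) (simp only: emb_def mult_2 scaleR_add_left, simp)
qed

lemma conj_eq: "x \<in> A \<Longrightarrow> cd_conj n x = emb (cnj (h x)) - w x"
  using conj_P[of "w x"] conj_emb[of "h x"] cd_conj_linear(1)[of n "emb (h x)" "w x"]
  by (simp add: emb_h_add_w)

lemma h_conj: "x \<in> A \<Longrightarrow> h (cd_conj n x) = cnj (h x)"
  and w_conj: "x \<in> A \<Longrightarrow> w (cd_conj n x) = - w x"
  by (simp_all add: conj_eq)

text \<open>Conjugation reverses products, and the signs from a^* = -a and b^* = -b cancel.\<close>

lemma mul_commute_P: "a \<in> P \<Longrightarrow> b \<in> P \<Longrightarrow> b \<odot> a = cd_conj n (a \<odot> b)"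
  by (simp add: cd_conj_mult conj_P)

lemma h_mul_commute: "a \<in> P \<Longrightarrow> b \<in> P \<Longrightarrow> h (b \<odot> a) = cnj (h (a \<odot> b))"
  and w_mul_commute: "a \<in> P \<Longrightarrow> b \<in> P \<Longrightarrow> w (b \<odot> a) = - w (a \<odot> b)"
  by (simp_all add: mul_commute_P[of a b] h_conj w_conj)

text \<open>\<open>(i u) v\<close> is \<open>(u v) i\<close>, and \<open>i\<close> commutes with \<open>\<complex>\<^sub>n\<close> but anticommutes with \<open>\<complex>\<^sub>n\<^sup>\<perp>\<close>.\<close>

lemma J_mul:
  assumes "u \<in> P" "v \<in> P"
  shows "J u \<odot> v = J (emb (h (u \<odot> v)) - w (u \<odot> v))"
proof -
  have i: "cd_conj n (cd_i n) = - cd_i n"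
    using conj_emb[of \<i>] by (simp add: emb_def)
  have "J u \<odot> v = cd_conj n (- J (v \<odot> u))"
    using assms by (simp add: mul_commute_P[of v "J u"] mul_J)
  also have "\<dots> = cd_conj n (v \<odot> u) \<odot> cd_i n"
    using assms n_ge_1 by (simp add: J_def cd_conj_neg cd_conj_mult cd_i_in_carrier i)
  also have "\<dots> = (u \<odot> v) \<odot> cd_i n"
    using assms by (simp add: mul_commute_P[of v u])
  also have "\<dots> = J (2 *\<^sub>R emb (h (u \<odot> v)) - (u \<odot> v))"
    using assms by (simp add: mul_i)
  also have "2 *\<^sub>R emb (h (u \<odot> v)) - (u \<odot> v) = emb (h (u \<odot> v)) - w (u \<odot> v)"
    by (simp add: w_def scaleR_2)
  finally show ?thesis .
qed

lemma J_mul_J: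
  assumes "u \<in> P" "v \<in> P"
  shows "J u \<odot> J v = emb (h (u \<odot> v)) - w (u \<odot> v)"
  using assms by (subst mul_J) (simp_all add: J_mul J_J)

lemma cd_orthogonal_iff:
  assumes "x \<in> A" "y \<in> A"
  shows "cd_orthogonal n x y \<longleftrightarrow> ip x y = 0"
proof -
  have "cd_inner n x y = ip x y *\<^sub>R cd_one n"
    using assms lookup_mult_conj_0[of x n y] unfolding cd_inner_def
    by (subst cd_Re_eq) (simp_all add: cd_conj_in_carrier)
  moreover have "cd_one n \<noteq> 0"
    unfolding cd_one_eq by simp
  ultimately show ?thesis
    by (simp add: cd_orthogonal_def)
qed

lemma Re_h_mul: "a \<in> P \<Longrightarrow> y \<in> A \<Longrightarrow> Re (h (a \<odot> y)) = - ip a y"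
  using lookup_mult_conj_0[of a n y] by (simp add: conj_P h_def)

lemma ip_skew: "a \<in> P \<Longrightarrow> x \<in> A \<Longrightarrow> y \<in> A \<Longrightarrow> ip (a \<odot> x) y = - ip x (a \<odot> y)"
  by (simp add: cd_ip_mult_left conj_P)

lemma ip_J:
  assumes "x \<in> A" "y \<in> A"
  shows "ip (J x) y = - ip x (J y)"
proof -
  have "cd_conj n (cd_i n) = - cd_i n"
    using conj_emb[of \<i>] by (simp add: emb_def)
  then show ?thesis
    using cd_ip_mult_left[OF cd_i_in_carrier[OF n_ge_1] assms] by (simp add: J_def)
qed

lemma w_mul_self:
  assumes "a \<in> P"
  shows "w (a \<odot> a) = 0"
proof -
  have "2 *\<^sub>R w (a \<odot> a) = 0"
    using w_mul_commute[OF assms assms] by (simp only: scaleR_2 eq_neg_iff_add_eq_0)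
  then show ?thesis by simp
qed

lemma h_mul_self: "a \<in> P \<Longrightarrow> h (a \<odot> a) = - complex_of_real (ip a a)"
  using h_mul_commute[of a a] Re_h_mul[of a a] by (simp add: complex_eq_iff)

lemma ip_pos: "a \<in> P \<Longrightarrow> a \<noteq> 0 \<Longrightarrow> ip a a > 0"
  using cd_ip_self_nonneg[of n a] cd_ip_self_eq_0_iff[of a n] by (simp add: order_less_le)

text \<open>The C_n-component of \<open>z\<close> contributes only a complex multiple of
  \<open>a\<close>, which lies in \<open>P\<close>.\<close>

lemma h_mul_w:
  assumes "a \<in> P" "z \<in> A"
  shows "h (a \<odot> w z) = h (a \<odot> z)"
proof -
  have "a \<odot> z = a \<odot> emb (h z) + a \<odot> w z"
    by (simp only: cd_mult_linear(2)[symmetric] emb_h_add_w)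
  then show ?thesis
    using assms by (simp add: mul_emb)
qed

lemma ip_P_emb: "u \<in> P \<Longrightarrow> ip u (emb \<alpha>) = 0"
  using Re_h_mul[of u "emb \<alpha>"] by (simp add: mul_emb)

lemma ip_w: "u \<in> P \<Longrightarrow> z \<in> A \<Longrightarrow> ip (w z) u = ip z u"
  using ip_P_emb[of u "h z"] by (simp add: w_def cd_ip_commute[of n _ u])

text \<open>The real part is <a a, x>, and a a lies in C_n. Replacing x by \<open>J x\<close>
  multiplies the value by \<i>, which settles the imaginary part.\<close>

lemma h_mul_mul_self:
  assumes "a \<in> P" "x \<in> P"
  shows "h (a \<odot> (a \<odot> x)) = 0"
proof -
  have *: "Re (h (a \<odot> (a \<odot> y))) = 0" if "y \<in> P" for y
  proof -
    have "a \<odot> a = emb (h (a \<odot> a))"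
      using w_mul_self[OF assms(1)] emb_h_add_w[of "a \<odot> a"] by simp
    then have "ip (a \<odot> a) y = 0"
      using ip_P_emb[OF that] cd_ip_commute by metis
    then show ?thesis
      using assms that by (simp add: Re_h_mul ip_skew[of a a y])
  qed
  have "h (a \<odot> (a \<odot> J x)) = \<i> * h (a \<odot> (a \<odot> x))"
    using assms by (simp add: mul_J)
  then show ?thesis
    using *[OF assms(2)] *[of "J x"] assms by (simp add: complex_eq_iff)
qed

text \<open>Left multiplication by \<open>a\<close> and \<open>J\<close> are skew and anticommute,
  so their composite is skew as well. The two skew maps give the vanishing of the real and of the
  imaginary part.\<close>

lemma h_mul_mul_skew:
  assumes "a \<in> P" "x \<in> P"
  shows "h (x \<odot> w (a \<odot> x)) = 0"
proof -
  have "Re (h (x \<odot> w (a \<odot> x))) = 0"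
    using assms ip_skew[of a x x] cd_ip_commute[of n x "a \<odot> x"] by (simp add: h_mul_w Re_h_mul)
  moreover have "Im (h (x \<odot> w (a \<odot> x))) = 0"
  proof -
    have "h (x \<odot> J (w (a \<odot> x))) = - \<i> * h (x \<odot> w (a \<odot> x))"
      using assms by (simp add: mul_J)
    moreover have "ip x (J (w (a \<odot> x))) = 0"
    proof -
      have "ip x (J (w (a \<odot> x))) = - ip (a \<odot> x) (J x)"
        using assms ip_J[of "w (a \<odot> x)" x] by (simp add: cd_ip_commute[of n x] ip_w)
      moreover have "ip (a \<odot> x) (J x) = ip x (J (a \<odot> x))"
        using assms by (simp add: ip_skew mul_J)
      moreover have "ip x (J (a \<odot> x)) = - ip (a \<odot> x) (J x)"
        using assms ip_J[of "a \<odot> x" x] by (simp add: cd_ip_commute[of n x])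
      ultimately show ?thesis by linarith
    qed
    moreover have "Re (h (x \<odot> J (w (a \<odot> x)))) = - ip x (J (w (a \<odot> x)))"
      by (rule Re_h_mul) (use assms in simp_all)
    ultimately have "Re (- \<i> * h (x \<odot> w (a \<odot> x))) = 0"
      by (simp only: neg_equal_0_iff_equal)
    then show ?thesis by simp
  qed
  ultimately show ?thesis
    by (simp add: complex_eq_iff)
qed

section \<open>Annihilators, Hermitian orthogonality and the D-locus\<close>

lemma Ann_iff: "y \<in> cd_Ann n a \<longleftrightarrow> y \<in> A \<and> a \<odot> y = 0"
  by (simp add: cd_Ann_def)

lemma J_in_Ann: "a \<in> P \<Longrightarrow> y \<in> cd_Ann n a \<Longrightarrow> J y \<in> cd_Ann n a"
  by (simp add: Ann_iff mul_J)

text \<open>If a z = 0 then 0 = <a z, a> = -<z, a a> = |a|^2 Re z. Since the annihilator is stable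
  under \<open>J\<close>, applying this to y and to \<open>J y\<close> kills both coordinates of
  \<open>h y\<close>.\<close>

lemma Ann_subset_P:
  assumes "a \<in> P" "a \<noteq> 0" "y \<in> cd_Ann n a"
  shows "y \<in> P"
proof -
  have *: "Re (h z) = 0" if "z \<in> A" "a \<odot> z = 0" for z
  proof -
    have "0 = ip (a \<odot> z) a"
      using that by simp
    also have "\<dots> = - ip z (a \<odot> a)"
      by (rule ip_skew) (use assms that in simp_all)
    also have "a \<odot> a = emb (h (a \<odot> a))"
      using w_mul_self[OF assms(1)] emb_h_add_w[of "a \<odot> a"] by simp
    also have "emb (h (a \<odot> a)) = (- ip a a) *\<^sub>R emb 1"
      using assms by (simp add: h_mul_self emb_def)
    also have "ip z (- ip a a *\<^sub>R emb 1) = - ip a a * Re (h z)"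
    proof -
      have "ip z (emb 1) = Re (h z)"
        using that lookup_mult_conj_0[of z n "emb 1"]
        by (simp add: emb_def cd_one_in_carrier cd_conj_one cd_mult_one h_def)
      then show ?thesis by simp
    qed
    finally show ?thesis
      using ip_pos[OF assms(1,2)] by simp
  qed
  have "h y = 0"
    using *[of y] *[of "J y"] assms(3) J_in_Ann[OF assms(1,3)] by (simp add: Ann_iff complex_eq_iff)
  then show ?thesis
    using assms(3) unfolding P_iff by (simp add: Ann_iff)
qed

text \<open>As b^* = -b, the Hermitian product is \<open>- emb (h (a \<odot> b))\<close> by
  uniqueness of the projection.\<close>

lemma cd_C_orthogonal_iff:
  assumes "a \<in> P" "b \<in> P"
  shows "cd_C_orthogonal n a b \<longleftrightarrow> h (a \<odot> b) = 0"
proof -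
  let ?z = "a \<odot> cd_conj n b"
  have z: "?z \<in> A"
    using assms by (simp add: conj_P)
  have "emb (h ?z) \<in> cd_C n"
    unfolding cd_C_iff emb_def by blast
  moreover have "\<forall>c\<in>cd_C n. cd_orthogonal n (?z - emb (h ?z)) c"
    using w_in_P[OF z] unfolding w_def cd_C_perp_def by blast
  ultimately have "cd_hermitian n a b = emb (h ?z)"
    unfolding cd_hermitian_def cd_proj_C_def
    by (intro the1_equality cd_proj_C_unique n_ge_1 z) blast
  moreover have "emb \<alpha> = 0 \<longleftrightarrow> \<alpha> = 0" for \<alpha>
    using h_emb[of \<alpha>] by (metis emb_linear(5) h_linear(5))
  ultimately show ?thesis
    using assms by (simp add: cd_C_orthogonal_def conj_P)
qed

text \<open>\<open>{x, y}\<close> without the factor \<open>1 / sqrt 2\<close>.\<close>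

definition brace :: "cd \<Rightarrow> cd \<Rightarrow> cd" where "brace x y = cd_pair n (x + y) (J (y - x))"

lemma cd_brace_eq: "cd_brace n a b = (1 / sqrt 2) *\<^sub>R brace a b"
  by (simp add: cd_brace_def brace_def J_def)

text \<open>\<open>D_locus\<close> only asserts that some representation as a brace satisfies the
  conditions; injectivity transfers them to the given pair.\<close>

lemma brace_inj:
  assumes "cd_brace n a b = cd_brace n a' b'" "a \<in> A" "b \<in> A" "a' \<in> A" "b' \<in> A"
  shows "a = a' \<and> b = b'"
proof -
  have eq: "brace a b = brace a' b'"
    using assms(1) by (simp add: cd_brace_eq)
  have s: "a + b = a' + b'"
    using arg_cong[OF eq, of "cd_fst n"] assms by (simp add: brace_def cd_fst_pair)
  have "J (b - a) = J (b' - a')"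
    using arg_cong[OF eq, of "cd_snd n"] by (simp add: brace_def cd_snd_pair)
  then have "- (b - a) = - (b' - a')"
    using J_J[of "b - a"] J_J[of "b' - a'"] assms by simp
  then have d: "b - a = b' - a'"
    by (simp only: neg_equal_iff_equal)
  have "2 *\<^sub>R b = (a + b) + (b - a)" "2 *\<^sub>R b' = (a' + b') + (b' - a')"
    by (simp_all add: scaleR_2)
  then have "2 *\<^sub>R b = 2 *\<^sub>R b'"
    using s d by simp
  then show ?thesis
    using s by simp
qed

text \<open>Annihilators are \<open>\<complex>\<^sub>n\<close>-subspaces, so real orthogonality to them amounts to \<open>\<complex>\<close>-orthogonality.\<close>

definition in_D :: "cd \<Rightarrow> cd \<Rightarrow> bool" where
  "in_D a b \<longleftrightarrow> h (a \<odot> b) = 0 \<and> (\<forall>y\<in>cd_Ann n b. h (a \<odot> y) = 0) \<and> (\<forall>y\<in>cd_Ann n a. h (b \<odot> y) = 0)"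

lemma orthogonal_Ann_iff:
  assumes "a \<in> P" "b \<in> P"
  shows "(\<forall>y\<in>cd_Ann n b. cd_orthogonal n a y) \<longleftrightarrow> (\<forall>y\<in>cd_Ann n b. h (a \<odot> y) = 0)"
proof
  assume *: "\<forall>y\<in>cd_Ann n b. cd_orthogonal n a y"
  have re: "Re (h (a \<odot> y)) = 0" if "y \<in> cd_Ann n b" for y
    using * that assms by (simp add: Re_h_mul cd_orthogonal_iff Ann_iff)
  show "\<forall>y\<in>cd_Ann n b. h (a \<odot> y) = 0"
  proof
    fix y assume y: "y \<in> cd_Ann n b"
    \<comment> \<open>\<open>J y\<close> also annihilates \<open>b\<close>, and its real part is the
      imaginary part for \<open>y\<close>.\<close>
    then have "h (a \<odot> J y) = - \<i> * h (a \<odot> y)"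
      using assms by (simp add: mul_J Ann_iff)
    then show "h (a \<odot> y) = 0"
      using re[OF y] re[OF J_in_Ann[OF assms(2) y]] by (simp add: complex_eq_iff)
  qed
next
  assume *: "\<forall>y\<in>cd_Ann n b. h (a \<odot> y) = 0"
  then show "\<forall>y\<in>cd_Ann n b. cd_orthogonal n a y"
    using assms Re_h_mul[of a] by (force simp: cd_orthogonal_iff Ann_iff)
qed

lemma D_locus_iff:
  assumes "a \<in> P" "b \<in> P"
  shows "cd_brace n a b \<in> D_locus n \<longleftrightarrow> in_D a b"
proof -
  have "cd_brace n a b \<in> D_locus n \<longleftrightarrow> cd_C_orthogonal n a b \<and>
     (\<forall>y\<in>cd_Ann n b. cd_orthogonal n a y) \<and> (\<forall>y\<in>cd_Ann n a. cd_orthogonal n b y)"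
    (is "?L \<longleftrightarrow> ?R a b")
  proof
    assume ?L
    then obtain a' b' where ab: "cd_brace n a b = cd_brace n a' b'" "a' \<in> P" "b' \<in> P" "?R a' b'"
      unfolding D_locus_def by blast
    then have "a = a' \<and> b = b'"
      using assms by (intro brace_inj) simp_all
    then show "?R a b"
      using ab(4) by blast
  next
    assume "?R a b"
    then show ?L
      unfolding D_locus_def using assms by blast
  qed
  then show ?thesis
    using assms by (simp add: in_D_def cd_C_orthogonal_iff orthogonal_Ann_iff)
qed

subsection \<open>The product of two braces\<close>

text \<open>The first half of the product in the doubled algebra. Swapping factors in
  \<open>P\<close> conjugates \<open>h\<close> and negates \<open>w\<close>, so the mixed terms a y
  and b x cancel in the \<open>P\<close>-component and leave only imaginary parts in C_n.\<close>

lemma brace_mul_fst: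
  assumes "a \<in> P" "b \<in> P" "x \<in> P" "y \<in> P"
  shows "(a + b) \<odot> (x + y + emb c) - cd_conj n (J (y - x) + emb d) \<odot> J (b - a) =
    emb (Complex (2 * Re (h (a \<odot> x) + h (b \<odot> y))) (2 * Im (h (a \<odot> y) + h (b \<odot> x)))) +
    (2 *\<^sub>R w (a \<odot> x) + 2 *\<^sub>R w (b \<odot> y) + sc (cnj c) (a + b) - sc (cnj d) (J (b - a)))"
    (is "?F = emb ?H + (?w1 + ?w2 + ?s1 - ?s2)")
proof -
  have 1: "(a + b) \<odot> (x + y + emb c) =
      (emb (h ((a + b) \<odot> (x + y))) + w ((a + b) \<odot> (x + y))) + ?s1"
    using assms by (simp only: cd_mult_linear(2)[of n "a + b" "x + y"] mul_emb emb_h_add_w P_closed)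
  have "cd_conj n (J (y - x) + emb d) = - J (y - x) + emb (cnj d)"
    using assms by (simp only: cd_conj_linear conj_emb conj_P J_in_P P_closed)
  then have 2: "cd_conj n (J (y - x) + emb d) \<odot> J (b - a) =
      - (emb (h ((y - x) \<odot> (b - a))) - w ((y - x) \<odot> (b - a))) + ?s2"
    using assms by (simp only: cd_mult_linear(1) cd_mult_neg J_mul_J emb_mul P_closed J_in_P P_in_A)
  note hc = h_mul_commute[OF assms(1,3)] h_mul_commute[OF assms(2,3)]
    h_mul_commute[OF assms(1,4)] h_mul_commute[OF assms(2,4)]
  have 3: "h ((a + b) \<odot> (x + y)) + h ((y - x) \<odot> (b - a)) = ?H"
    by (simp add: cd_mult_linear cd_mult_diff complex_eq_iff hc)
  note wc = w_mul_commute[OF assms(1,3)] w_mul_commute[OF assms(2,3)]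
    w_mul_commute[OF assms(1,4)] w_mul_commute[OF assms(2,4)]
  have 4: "w ((a + b) \<odot> (x + y)) - w ((y - x) \<odot> (b - a)) = ?w1 + ?w2"
    by (intro poly_mapping_eqI)
      (simp add: cd_mult_linear cd_mult_diff wc lookup_add lookup_minus lookup_numeral_mult)
  have "?F = emb (h ((a + b) \<odot> (x + y)) + h ((y - x) \<odot> (b - a))) +
      ((w ((a + b) \<odot> (x + y)) - w ((y - x) \<odot> (b - a))) + ?s1 - ?s2)"
    unfolding 1 2 by simp
  then show ?thesis
    unfolding 3 4 .
qed

text \<open>The second half, with the same cancellations; here the mixed terms leave real parts and
  the others imaginary parts, up to the factor \<i> from \<open>J\<close>.\<close>

lemma brace_mul_snd:
  assumes "a \<in> P" "b \<in> P" "x \<in> P" "y \<in> P"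
  shows "(J (y - x) + emb d) \<odot> (a + b) + J (b - a) \<odot> cd_conj n (x + y + emb c) =
    emb (\<i> * Complex (2 * Re (h (a \<odot> y) - h (b \<odot> x))) (2 * Im (h (a \<odot> x) - h (b \<odot> y)))) +
    (J (2 *\<^sub>R w (b \<odot> y) - 2 *\<^sub>R w (a \<odot> x)) + sc d (a + b) + sc c (J (b - a)))"
    (is "?F = emb (\<i> * ?H) + (J (?w2 - ?w1) + ?s1 + ?s2)")
proof -
  have 1: "(J (y - x) + emb d) \<odot> (a + b) =
      J (emb (h ((y - x) \<odot> (a + b))) - w ((y - x) \<odot> (a + b))) + ?s1"
    using assms by (simp only: cd_mult_linear(1) J_mul emb_mul P_closed P_in_A)
  have "cd_conj n (x + y + emb c) = - (x + y) + emb (cnj c)"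
    using assms by (simp only: cd_conj_linear(1)[of n "x + y"] conj_emb conj_P P_closed)
  then have 2: "J (b - a) \<odot> cd_conj n (x + y + emb c) =
      - J (emb (h ((b - a) \<odot> (x + y))) - w ((b - a) \<odot> (x + y))) + ?s2"
    using assms by (simp only: cd_mult_linear(2)[of n "J (b - a)" "- (x + y)"] cd_mult_neg J_mul
        mul_emb P_closed J_in_P complex_cnj_cnj)
  note hc = h_mul_commute[OF assms(1,3)] h_mul_commute[OF assms(2,3)]
    h_mul_commute[OF assms(1,4)] h_mul_commute[OF assms(2,4)]
  have 3: "h ((y - x) \<odot> (a + b)) - h ((b - a) \<odot> (x + y)) = ?H"
    by (simp add: cd_mult_linear cd_mult_diff complex_eq_iff hc)
  note wc = w_mul_commute[OF assms(1,3)] w_mul_commute[OF assms(2,3)]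
    w_mul_commute[OF assms(1,4)] w_mul_commute[OF assms(2,4)]
  have 4: "w ((b - a) \<odot> (x + y)) - w ((y - x) \<odot> (a + b)) = ?w2 - ?w1"
    by (intro poly_mapping_eqI)
      (simp add: cd_mult_linear cd_mult_diff wc lookup_add lookup_minus lookup_numeral_mult)
  have "?F = J (emb (h ((y - x) \<odot> (a + b)) - h ((b - a) \<odot> (x + y)))) +
      (J (w ((b - a) \<odot> (x + y)) - w ((y - x) \<odot> (a + b))) + ?s1 + ?s2)"
    unfolding 1 2 by simp
  then show ?thesis
    unfolding 3 4 J_emb .
qed

lemma emb_add_eq_0_iff:
  assumes "u \<in> P"
  shows "emb \<alpha> + u = 0 \<longleftrightarrow> \<alpha> = 0 \<and> u = 0"
proof
  assume *: "emb \<alpha> + u = 0"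
  have "h (emb \<alpha> + u) = 0" "w (emb \<alpha> + u) = 0"
    unfolding * by simp_all
  then show "\<alpha> = 0 \<and> u = 0"
    using assms by simp
qed simp

lemma cd_pair_eq_0_iff: "u \<in> A \<Longrightarrow> cd_pair n u v = 0 \<longleftrightarrow> u = 0 \<and> v = 0"
  by (metis cd_fst_pair cd_fst_zero cd_pair_zero cd_snd_pair cd_snd_zero)

lemma brace_mul_eq_0_iff:
  fixes a b x y c d
  assumes ab: "a \<in> P" "b \<in> P" and xy: "x \<in> P" "y \<in> P"
  defines "\<alpha> \<equiv> Complex (Re c) (Re d)" and "\<beta> \<equiv> Complex (Im d) (Im c)"
  shows "cd_mult (Suc n) (brace a b) (cd_pair n (x + y + emb c) (J (y - x) + emb d)) = 0 \<longleftrightarrow>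
    2 *\<^sub>R w (a \<odot> x) + sc \<alpha> a - sc \<beta> b = 0 \<and>
    2 *\<^sub>R w (b \<odot> y) + sc (cnj \<beta>) a + sc (cnj \<alpha>) b = 0 \<and>
    h (a \<odot> x) + cnj (h (b \<odot> y)) = 0 \<and> h (a \<odot> y) = cnj (h (b \<odot> x))"
proof -
  let ?W1 = "2 *\<^sub>R w (a \<odot> x) + 2 *\<^sub>R w (b \<odot> y) + sc (cnj c) (a + b) - sc (cnj d) (J (b - a))"
  let ?W2 = "J (2 *\<^sub>R w (b \<odot> y) - 2 *\<^sub>R w (a \<odot> x)) + sc d (a + b) + sc c (J (b - a))"
  let ?E1 = "2 *\<^sub>R w (a \<odot> x) + sc \<alpha> a - sc \<beta> b"
  let ?E2 = "2 *\<^sub>R w (b \<odot> y) + sc (cnj \<beta>) a + sc (cnj \<alpha>) b"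
  have W: "?W1 \<in> P" "?W2 \<in> P"
    using assms(1-4) by simp_all
  have "cd_mult (Suc n) (brace a b) (cd_pair n (x + y + emb c) (J (y - x) + emb d)) = 0 \<longleftrightarrow>
    (emb (Complex (2 * Re (h (a \<odot> x) + h (b \<odot> y))) (2 * Im (h (a \<odot> y) + h (b \<odot> x)))) + ?W1 = 0 \<and>
    emb (\<i> * Complex (2 * Re (h (a \<odot> y) - h (b \<odot> x))) (2 * Im (h (a \<odot> x) - h (b \<odot> y)))) + ?W2 = 0)"
    using assms(1-4) W unfolding brace_def
    by (subst cd_mult_pair)
      (simp_all only: A_closed P_in_A emb_in_A brace_mul_fst brace_mul_snd cd_pair_eq_0_iff)
  \<comment> \<open>Each half supplies one real part and one imaginary part; regrouped across the
    halves they form two complex equations.\<close>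
  also have "\<dots> \<longleftrightarrow> (?W1 = 0 \<and> ?W2 = 0) \<and>
      h (a \<odot> x) + cnj (h (b \<odot> y)) = 0 \<and> h (a \<odot> y) = cnj (h (b \<odot> x))"
    unfolding emb_add_eq_0_iff[OF W(1)] emb_add_eq_0_iff[OF W(2)]
    by (auto simp: complex_eq_iff)
  also have "?W1 = 0 \<and> ?W2 = 0 \<longleftrightarrow> ?E1 = 0 \<and> ?E2 = 0"
  proof -
    have JJ: "J (J z) = - z" if "z \<in> P" for z
      using that by (simp add: J_J)
    \<comment> \<open>Adding and subtracting \<open>J ?W2\<close> separates a x from b y and merges
      the four real parameters of c and d into \<alpha> and \<beta>.\<close>
    have e1: "2 *\<^sub>R ?E1 = ?W1 + J ?W2" and e2: "2 *\<^sub>R ?E2 = ?W1 - J ?W2"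
      using assms(1-4) by (auto intro!: poly_mapping_eqI
          simp: sc_def JJ \<alpha>_def \<beta>_def lookup_add lookup_minus lookup_numeral_mult algebra_simps)
    have "J ?W2 = 0 \<longleftrightarrow> ?W2 = 0"
      using JJ[OF W(2)] by (metis J_linear(5) neg_equal_0_iff_equal)
    then show ?thesis
      using add_diff_eq_0_iff[OF e1 e2] by blast
  qed
  finally show ?thesis by blast
qed

section \<open>Parameters for the annihilator of a brace\<close>

lemma decompose_pair:
  assumes "z \<in> cd_carrier (Suc n)"
  obtains x y c d where "x \<in> P" "y \<in> P" "z = cd_pair n (x + y + emb c) (J (y - x) + emb d)"
proof -
  let ?f = "cd_fst n z" and ?s = "cd_snd n z"
  have c: "?f \<in> A" "?s \<in> A"
    using assms by (auto intro: cd_fst_in_carrier cd_snd_in_carrier)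
  \<comment> \<open>\<open>x\<close> and \<open>y\<close> solve x + y = \<open>w ?f\<close> and
    \<open>J (y - x)\<close> = \<open>w ?s\<close>.\<close>
  define x where "x = (1 / 2) *\<^sub>R (w ?f + J (w ?s))"
  define y where "y = (1 / 2) *\<^sub>R (w ?f - J (w ?s))"
  have "x + y = w ?f"
    by (rule poly_mapping_eqI) (simp add: x_def y_def lookup_add lookup_minus lookup_numeral_mult field_simps)
  moreover have "y - x = - J (w ?s)"
    by (rule poly_mapping_eqI) (simp add: x_def y_def lookup_add lookup_minus lookup_numeral_mult field_simps)
  ultimately have "z = cd_pair n (x + y + emb (h ?f)) (J (y - x) + emb (h ?s))"
    using c by (simp add: J_J cd_pair_fst_snd emb_h_add_w add.commute[of "w u" for u])
  moreover have "x \<in> P" "y \<in> P"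
    using c by (simp_all add: x_def y_def)
  ultimately show ?thesis
    using that by blast
qed

text \<open>Multiply the first equation by \<open>a\<close> and the second by \<open>b\<close> and
  apply \<open>h\<close>; the quadratic terms vanish by \<open>h_mul_mul_self\<close>. After
  conjugating the second result, both have the same term in \<beta>, and eliminating it leaves
  \<alpha>^* (|a|^2 + |b|^2) = 0.\<close>

lemma alpha_eq_0:
  assumes ab: "a \<in> P" "b \<in> P" "a \<noteq> 0" "b \<noteq> 0" and xy: "x \<in> P" "y \<in> P"
    and 1: "2 *\<^sub>R w (a \<odot> x) + sc \<alpha> a - sc \<beta> b = 0"
    and 2: "2 *\<^sub>R w (b \<odot> y) + sc (cnj \<beta>) a + sc (cnj \<alpha>) b = 0"
  shows "\<alpha> = 0"
proof -
  have "h (a \<odot> (2 *\<^sub>R w (a \<odot> x) + sc \<alpha> a - sc \<beta> b)) = 0"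
    unfolding 1 by simp
  then have 3: "- (cnj \<alpha> * complex_of_real (ip a a)) = cnj \<beta> * h (a \<odot> b)"
    using ab xy by (simp add: cd_mult_linear cd_mult_diff h_mul_w h_mul_mul_self mul_sc h_mul_self)
  have "h (b \<odot> (2 *\<^sub>R w (b \<odot> y) + sc (cnj \<beta>) a + sc (cnj \<alpha>) b)) = 0"
    unfolding 2 by simp
  then have "\<alpha> * complex_of_real (ip b b) = \<beta> * cnj (h (a \<odot> b))"
    using ab xy by (simp add: cd_mult_linear cd_mult_diff h_mul_w h_mul_mul_self mul_sc h_mul_self
        h_mul_commute[of a b])
  then have "cnj (\<alpha> * complex_of_real (ip b b)) = cnj (\<beta> * cnj (h (a \<odot> b)))"
    by (rule arg_cong)
  then have "cnj \<alpha> * complex_of_real (ip b b) = cnj \<beta> * h (a \<odot> b)"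
    by (simp only: complex_cnj_mult complex_cnj_cnj complex_cnj_complex_of_real)
  then have "cnj \<alpha> * complex_of_real (ip a a + ip b b) = 0"
    unfolding of_real_add distrib_left using 3 by (metis add.right_inverse)
  moreover have "ip a a + ip b b > 0"
    using ip_pos ab by (simp add: add_pos_pos)
  ultimately show ?thesis
    by (metis complex_cnj_zero_iff less_irrefl mult_eq_0_iff of_real_eq_0_iff)
qed

text \<open>\<open>{x, y} + (c, d)\<close> with \<open>c = i Im \<beta>\<close> and \<open>d = i Re \<beta>\<close>, that is \<open>\<alpha> = 0\<close>.\<close>

definition param_elem :: "cd \<times> cd \<times> complex \<Rightarrow> cd" where
  "param_elem = (\<lambda>(x, y, \<beta>). cd_pair n (x + y + emb (\<i> * of_real (Im \<beta>))) (J (y - x) + emb (\<i> * of_real (Re \<beta>))))"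

text \<open>The system of \<open>brace_mul_eq_0_iff\<close> at \<alpha> = 0; its solutions
  parametrize the annihilator (\<open>Ann_brace\<close>).\<close>

definition Ann_params :: "cd \<Rightarrow> cd \<Rightarrow> (cd \<times> cd \<times> complex) set" where
  "Ann_params a b = {(x, y, \<beta>). x \<in> P \<and> y \<in> P \<and> 2 *\<^sub>R w (a \<odot> x) = sc \<beta> b \<and> 2 *\<^sub>R w (b \<odot> y) = - sc (cnj \<beta>) a \<and>
    h (a \<odot> x) + cnj (h (b \<odot> y)) = 0 \<and> h (a \<odot> y) = cnj (h (b \<odot> x))}"

lemma Ann_brace:
  assumes ab: "a \<in> P" "b \<in> P" "a \<noteq> 0" "b \<noteq> 0"
  shows "cd_Ann (Suc n) (cd_brace n a b) = param_elem ` Ann_params a b"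
proof -
  have Ann: "z \<in> cd_Ann (Suc n) (cd_brace n a b) \<longleftrightarrow>
      z \<in> cd_carrier (Suc n) \<and> cd_mult (Suc n) (brace a b) z = 0" for z
    unfolding cd_Ann_def cd_brace_eq cd_mult_linear(3) by simp
  show ?thesis
  proof (intro subset_antisym subsetI)
    fix z assume z: "z \<in> cd_Ann (Suc n) (cd_brace n a b)"
    then obtain x y c d where xy: "x \<in> P" "y \<in> P"
      and zeq: "z = cd_pair n (x + y + emb c) (J (y - x) + emb d)"
      using decompose_pair Ann by metis
    define \<alpha> where "\<alpha> = Complex (Re c) (Re d)"
    define \<beta> where "\<beta> = Complex (Im d) (Im c)"
    have "cd_mult (Suc n) (brace a b) (cd_pair n (x + y + emb c) (J (y - x) + emb d)) = 0"
      using z Ann zeq by blast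
    note eqs = this[unfolded brace_mul_eq_0_iff[OF ab(1,2) xy], folded \<alpha>_def \<beta>_def]
    have "\<alpha> = 0"
      using alpha_eq_0[OF ab xy] eqs by blast
    then have "c = \<i> * of_real (Im \<beta>)" "d = \<i> * of_real (Re \<beta>)"
      by (simp_all add: \<alpha>_def \<beta>_def complex_eq_iff)
    then have "z = param_elem (x, y, \<beta>)"
      by (simp add: param_elem_def zeq)
    moreover have "(x, y, \<beta>) \<in> Ann_params a b"
      using eqs xy unfolding \<open>\<alpha> = 0\<close> Ann_params_def by (simp add: eq_neg_iff_add_eq_0)
    ultimately show "z \<in> param_elem ` Ann_params a b" by blast
  next
    fix z assume "z \<in> param_elem ` Ann_params a b"
    then obtain x y \<beta> where Y: "(x, y, \<beta>) \<in> Ann_params a b" and z: "z = param_elem (x, y, \<beta>)"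
      by auto
    let ?c = "\<i> * of_real (Im \<beta>)" and ?d = "\<i> * of_real (Re \<beta>)"
    have xy: "x \<in> P" "y \<in> P"
      using Y by (simp_all add: Ann_params_def)
    have zeq: "z = cd_pair n (x + y + emb ?c) (J (y - x) + emb ?d)"
      by (simp add: z param_elem_def)
    have "Complex (Re ?c) (Re ?d) = 0" "Complex (Im ?d) (Im ?c) = \<beta>"
      by (simp_all add: complex_eq_iff)
    then have "cd_mult (Suc n) (brace a b) z = 0"
      unfolding zeq brace_mul_eq_0_iff[OF ab(1,2) xy] using Y by (simp add: Ann_params_def)
    moreover have "z \<in> cd_carrier (Suc n)"
      unfolding zeq using xy by (intro cd_pair_in_carrier) simp
    ultimately show "z \<in> cd_Ann (Suc n) (cd_brace n a b)"
      using Ann by blast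
  qed
qed

lemma linear_w_mul: "linear (\<lambda>x. w (a \<odot> x))"
  by (rule linearI) (simp_all add: cd_mult_linear)

subsection \<open>Counting dimensions\<close>

lemma subspace_P: "subspace P"
  by (simp add: subspace_def)

lemma sc_emb: "sc \<alpha> (emb \<beta>) = emb (\<alpha> * \<beta>)"
  by (simp add: sc_def J_emb) (simp add: emb_def algebra_simps)

text \<open>\<open>- c\<^sup>* a / |a|\<^sup>2\<close>, the solution of \<open>a x = c\<close> along \<open>a\<close> (here \<open>a a = - |a|\<^sup>2\<close>).\<close>

definition solve :: "cd \<Rightarrow> complex \<Rightarrow> cd" where "solve a c = sc (- cnj c / of_real (ip a a)) a"

lemma solve:
  assumes "a \<in> P" "a \<noteq> 0"
  shows "solve a c \<in> P" "a \<odot> solve a c = emb c"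
proof -
  have aa: "a \<odot> a = emb (- of_real (ip a a))"
    using w_mul_self[OF assms(1)] emb_h_add_w[of "a \<odot> a"] h_mul_self[OF assms(1)] by simp
  show "solve a c \<in> P"
    using assms by (simp add: solve_def)
  have "a \<odot> solve a c = emb (cnj (- cnj c / of_real (ip a a)) * (- of_real (ip a a)))"
    using assms unfolding solve_def by (simp only: mul_sc P_in_A aa sc_emb)
  also have "cnj (- cnj c / of_real (ip a a)) * (- of_real (ip a a)) = c"
    using ip_pos[OF assms] by simp
  finally show "a \<odot> solve a c = emb c" .
qed

text \<open>Here a x lies in C_n, and \<open>solve\<close> gives a multiple of \<open>a\<close> with
  the same product. So the kernel of \<open>w (a \<odot> x)\<close> in \<open>x\<close> is Ann a
  plus the complex multiples of \<open>a\<close>.\<close>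

lemma ker_w_mul:
  assumes "a \<in> P" "a \<noteq> 0" "x \<in> P" "w (a \<odot> x) = 0"
  shows "x - solve a (h (a \<odot> x)) \<in> cd_Ann n a"
  using assms solve[OF assms(1,2)] emb_h_add_w[of "a \<odot> x"] by (simp add: Ann_iff cd_mult_diff)

lemma in_D_commute: "a \<in> P \<Longrightarrow> b \<in> P \<Longrightarrow> in_D a b \<longleftrightarrow> in_D b a"
  using h_mul_commute[of a b] by (auto simp: in_D_def)

text \<open>Both parts of the kernel described by \<open>ker_w_mul\<close> are \<complex>-orthogonal
  to \<open>b\<close> on the D-locus.\<close>

lemma in_D_ker:
  assumes "a \<in> P" "b \<in> P" "a \<noteq> 0" "in_D a b" "x \<in> P" "w (a \<odot> x) = 0"
  shows "h (b \<odot> x) = 0"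
proof -
  let ?s = "solve a (h (a \<odot> x))"
  have "h (b \<odot> (x - ?s)) = 0"
    using assms(4) ker_w_mul[OF assms(1,3,5,6)] unfolding in_D_def by blast
  moreover have "h (b \<odot> ?s) = 0"
    using assms h_mul_commute[of a b] by (simp add: solve_def mul_sc in_D_def)
  ultimately show ?thesis
    by (simp add: cd_mult_diff)
qed

text \<open>The map \<open>w (a \<odot> x)\<close> is skew on \<open>P\<close>, and by
  \<open>in_D_ker\<close> every multiple of \<open>b\<close> is orthogonal to its kernel, so
  \<open>skew_image\<close> applies.\<close>

lemma in_D_solvable:
  assumes "a \<in> P" "b \<in> P" "a \<noteq> 0" "in_D a b"
  obtains x where "x \<in> P" "2 *\<^sub>R w (a \<odot> x) = sc \<beta> b"
proof -
  have skew: "ip (w (a \<odot> x)) y = - ip x (w (a \<odot> y))" if "x \<in> P" "y \<in> P" for x y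
    using assms that by (simp add: ip_w ip_skew cd_ip_commute[of n x "w (a \<odot> y)"])
      (simp add: ip_w ip_skew cd_ip_commute[of n x "a \<odot> y"])
  have orth: "ip (sc (\<beta> / 2) b) u = 0" if "u \<in> P" "w (a \<odot> u) = 0" for u
  proof -
    have "h (u \<odot> b) = 0"
      using in_D_ker[OF assms that] h_mul_commute[of b u] assms that by simp
    then have "h (u \<odot> sc (\<beta> / 2) b) = 0"
      using assms that by (simp add: mul_sc)
    then show ?thesis
      using Re_h_mul[of u "sc (\<beta> / 2) b"] assms that cd_ip_commute[of n u] by simp
  qed
  have "P \<subseteq> A"
    by auto
  moreover note linear_w_mul[of a]
  ultimately obtain x where x: "x \<in> P" "w (a \<odot> x) = sc (\<beta> / 2) b"
    using skew_image[OF subspace_P, of n "\<lambda>x. w (a \<odot> x)" "sc (\<beta> / 2) b"] assms skew orth by auto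
  have "2 *\<^sub>R w (a \<odot> x) = sc \<beta> b"
    using x(2) sc_scaleR_left[of 2 "\<beta> / 2" b] by simp
  with x(1) that show ?thesis by blast
qed

text \<open>By \<open>h_mul_mul_skew\<close>, \<open>x\<close> is \<complex>-orthogonal to
  \<open>w (a \<odot> x)\<close>, which here is a nonzero multiple of \<open>b\<close>.\<close>

lemma solution_orthogonal:
  assumes "a \<in> P" "b \<in> P" "x \<in> P" "2 *\<^sub>R w (a \<odot> x) = sc \<beta> b" "\<beta> \<noteq> 0"
  shows "h (b \<odot> x) = 0"
proof -
  have "h (x \<odot> (2 *\<^sub>R w (a \<odot> x))) = 0"
    using assms(1,3) by (simp add: cd_mult_linear h_mul_mul_skew)
  then have "h (x \<odot> b) = 0"
    unfolding assms(4) using assms by (simp add: mul_sc)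
  then show ?thesis
    using h_mul_commute[of x b] assms by simp
qed

text \<open>For v in Ann a, <v, a x> = -<a v, x> = 0; taking v = u and v = \<open>J u\<close> gives
  the real and the imaginary part.\<close>

lemma h_Ann_mul:
  assumes "a \<in> P" "a \<noteq> 0" "x \<in> P" "u \<in> cd_Ann n a"
  shows "h (u \<odot> w (a \<odot> x)) = 0"
proof -
  have re: "Re (h (v \<odot> w (a \<odot> x))) = 0" if v: "v \<in> cd_Ann n a" for v
  proof -
    have vP: "v \<in> P" "a \<odot> v = 0"
      using Ann_subset_P[OF assms(1,2) v] v by (simp_all add: Ann_iff)
    then have "ip v (a \<odot> x) = 0"
      using ip_skew[of a v x] assms by simp
    then show ?thesis
      using vP assms by (simp add: h_mul_w Re_h_mul)
  qed
  have u: "u \<in> P"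
    using Ann_subset_P assms by blast
  have w: "w (a \<odot> x) \<in> P"
    using assms by simp
  have "h (J u \<odot> w (a \<odot> x)) = \<i> * h (u \<odot> w (a \<odot> x))"
    using h_mul_commute[OF w J_in_P[OF u]] h_mul_commute[OF w u] u w by (simp add: mul_J)
  then have "Re (\<i> * h (u \<odot> w (a \<odot> x))) = 0"
    using re[OF J_in_Ann[OF assms(1,4)]] by simp
  then show ?thesis
    using re[OF assms(4)] by (simp add: complex_eq_iff)
qed

text \<open>\<open>w (a \<odot> x)\<close> is always \<complex>-orthogonal to \<open>a\<close> and
  to Ann a; when it is a nonzero multiple of \<open>b\<close>, so is \<open>b\<close>.\<close>

lemma solution_imp_in_D:
  assumes "a \<in> P" "b \<in> P" "a \<noteq> 0" "x \<in> P" "2 *\<^sub>R w (a \<odot> x) = sc \<beta> b" "\<beta> \<noteq> 0"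
  shows "h (a \<odot> b) = 0" "u \<in> cd_Ann n a \<Longrightarrow> h (b \<odot> u) = 0"
proof -
  have "h (a \<odot> (2 *\<^sub>R w (a \<odot> x))) = 0"
    using assms(1,4) by (simp add: cd_mult_linear h_mul_w h_mul_mul_self)
  then show "h (a \<odot> b) = 0"
    unfolding assms(5) using assms by (simp add: mul_sc)
  assume u: "u \<in> cd_Ann n a"
  have uP: "u \<in> P"
    using Ann_subset_P assms u by blast
  have "h (u \<odot> (2 *\<^sub>R w (a \<odot> x))) = 0"
    using assms(1,3,4) u by (simp add: cd_mult_linear h_Ann_mul)
  then have "h (u \<odot> b) = 0"
    unfolding assms(5) using assms uP by (simp add: mul_sc)
  then show "h (b \<odot> u) = 0"
    using h_mul_commute[of u b] assms uP by simp
qed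

text \<open>\<open>x\<close> gives the condition on \<open>b\<close> and Ann a. Exchanging
  \<open>a\<close> with \<open>b\<close>, \<open>x\<close> with \<open>y\<close> and \<beta> with
  -\<beta>^* gives the other one.\<close>

lemma Ann_params_imp_in_D:
  assumes ab: "a \<in> P" "b \<in> P" "a \<noteq> 0" "b \<noteq> 0" and "(x, y, \<beta>) \<in> Ann_params a b" "\<beta> \<noteq> 0"
  shows "in_D a b"
proof -
  have xy: "x \<in> P" "y \<in> P" "2 *\<^sub>R w (a \<odot> x) = sc \<beta> b" "2 *\<^sub>R w (b \<odot> y) = sc (- cnj \<beta>) a"
    using assms(5) by (simp_all add: Ann_params_def)
  have "- cnj \<beta> \<noteq> 0"
    using assms(6) by simp
  then show ?thesis
    using solution_imp_in_D[OF ab(1,2,3) xy(1,3) assms(6)]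
      solution_imp_in_D[OF ab(2,1,4) xy(2,4)] by (simp add: in_D_def)
qed

lemma in_D_imp_Ann_params:
  assumes ab: "a \<in> P" "b \<in> P" "a \<noteq> 0" "b \<noteq> 0" and D: "in_D a b"
  obtains x y where "(x, y, \<beta>) \<in> Ann_params a b"
proof (cases "\<beta> = 0")
  case True
  then have "(0, 0, \<beta>) \<in> Ann_params a b"
    by (simp add: Ann_params_def)
  with that show ?thesis by blast
next
  case False
  obtain x0 where x0: "x0 \<in> P" "2 *\<^sub>R w (a \<odot> x0) = sc \<beta> b"
    using in_D_solvable[OF ab(1-3) D] by blast
  obtain y where y: "y \<in> P" "2 *\<^sub>R w (b \<odot> y) = sc (- cnj \<beta>) a"
    using in_D_solvable[OF ab(2,1,4)] D in_D_commute[OF ab(1,2)] by blast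
  \<comment> \<open>Adding \<open>solve a c\<close> to \<open>x0\<close> shifts
    \<open>h (a \<odot> x0)\<close> by \<open>c\<close> without changing the
    \<open>P\<close>-component, so the first scalar equation can be met. Both sides of the second
    one vanish by \<open>solution_orthogonal\<close>.\<close>
  define c where "c = - cnj (h (b \<odot> y)) - h (a \<odot> x0)"
  define x where "x = x0 + solve a c"
  have x: "x \<in> P" "a \<odot> x = a \<odot> x0 + emb c"
    using x0 solve[OF ab(1,3)] by (simp_all add: x_def cd_mult_linear)
  then have wx: "2 *\<^sub>R w (a \<odot> x) = sc \<beta> b"
    using x0 by simp
  have "h (a \<odot> x) + cnj (h (b \<odot> y)) = 0"
    using x by (simp add: c_def)
  moreover have "h (b \<odot> x) = 0"
    by (rule solution_orthogonal[OF ab(1,2) x(1) wx False])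
  moreover have "h (a \<odot> y) = 0"
    by (rule solution_orthogonal[OF ab(2,1) y]) (use False in simp)
  ultimately have "(x, y, \<beta>) \<in> Ann_params a b"
    using x(1) wx y by (simp add: Ann_params_def)
  with that show ?thesis by blast
qed

section \<open>The solutions with \<beta> = 0 and the final count\<close>

definition beta0_params :: "cd \<Rightarrow> cd \<Rightarrow> (cd \<times> cd \<times> complex) set" where
  "beta0_params a b = {(x, y, \<beta>). \<beta> = 0 \<and> x \<in> P \<and> y \<in> P \<and> w (a \<odot> x) = 0 \<and> w (b \<odot> y) = 0 \<and>
    h (a \<odot> x) + cnj (h (b \<odot> y)) = 0}"

text \<open>Measures the equation of \<open>Ann_params\<close> that \<open>beta0_params\<close>
  omits. Its kernel there is exactly the part of \<open>Ann_params\<close> with \<beta> = 0, since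
  both are kept as sets of triples.\<close>

definition defect :: "cd \<Rightarrow> cd \<Rightarrow> cd \<times> cd \<times> complex \<Rightarrow> complex" where
  "defect a b = (\<lambda>(x, y, \<beta>). h (a \<odot> y) - cnj (h (b \<odot> x)))"

lemma linear_defect: "linear (defect a b)"
  by (rule linearI) (auto simp: defect_def cd_mult_linear scaleR_conv_of_real algebra_simps)

text \<open>The conjugations make the equations only real-linear, so the space is presented as a
  kernel of a real-linear map.\<close>

lemma subspace_beta0_params: "subspace (beta0_params a b)"
proof -
  define F where "F = (\<lambda>(x, y, \<beta>::complex). (\<beta>, w (a \<odot> x), w (b \<odot> y), h (a \<odot> x) + cnj (h (b \<odot> y))))"
  have "linear F"
    by (rule linearI) (auto simp: F_def cd_mult_linear scaleR_conv_of_real distrib_left)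
  moreover have "beta0_params a b = P \<times> P \<times> UNIV \<inter> {p. F p = 0}"
    by (auto simp: beta0_params_def F_def zero_prod_def)
  ultimately show ?thesis
    by (simp only: subspace_inter subspace_Times subspace_P subspace_UNIV linear_subspace_kernel)
qed

lemma subspace_Ann_params: "subspace (Ann_params a b)"
proof -
  define F where "F = (\<lambda>(x, y, \<beta>). (2 *\<^sub>R w (a \<odot> x) - sc \<beta> b, 2 *\<^sub>R w (b \<odot> y) + sc (cnj \<beta>) a,
    h (a \<odot> x) + cnj (h (b \<odot> y)), h (a \<odot> y) - cnj (h (b \<odot> x))))"
  have "linear F"
    by (rule linearI) (auto simp: F_def cd_mult_linear scaleR_conv_of_real sc_add_left
        sc_scaleR_left scaleR_right_distrib scaleR_right_diff_distrib distrib_left right_diff_distrib)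
  moreover have "Ann_params a b = P \<times> P \<times> UNIV \<inter> {p. F p = 0}"
    by (auto simp: Ann_params_def F_def zero_prod_def eq_neg_iff_add_eq_0)
  ultimately show ?thesis
    by (simp only: subspace_inter subspace_Times subspace_P subspace_UNIV linear_subspace_kernel)
qed

text \<open>Supplies the finite spanning set that \<open>rank_nullity\<close> asks for on spaces of
  triples.\<close>

lemma subset_span_carrier:
  assumes "V \<subseteq> A \<times> A \<times> UNIV"
  obtains B :: "(cd \<times> cd \<times> complex) set" where "finite B" "V \<subseteq> span B"
proof -
  have "UNIV \<subseteq> span (Basis :: complex set)"
    by (simp add: span_Basis)
  from subset_span_Times[OF cd_carrier_subset_span subset_span_Times[OF cd_carrier_subset_span this]]
  show ?thesis
    using that[OF _ subset_trans[OF assms]] by (metis finite_Basis finite_UnI finite_imageI finite_lessThan)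
qed

lemma dim_zero_singleton: "dim {0 :: 'b::real_vector} = 0"
  using dim_eq_card_independent[OF independent_empty, where 'a='b] dim_span[of "{}::'b set"] by simp

lemma complex_subspace_UNIV:
  assumes "subspace S" "\<And>z. z \<in> S \<Longrightarrow> \<i> * z \<in> S" "z \<in> S" "z \<noteq> 0"
  shows "S = UNIV"
proof -
  have "c \<in> S" for c
  proof -
    have "c = Re (c / z) *\<^sub>R z + Im (c / z) *\<^sub>R (\<i> * z)"
    proof -
      have "Re (c / z) *\<^sub>R z + Im (c / z) *\<^sub>R (\<i> * z) = (c / z) * z"
        by (subst (3) complex_eq) (simp add: scaleR_conv_of_real algebra_simps)
      then show ?thesis
        using assms(4) by simp
    qed
    also have "\<dots> \<in> S"
      using assms by (intro subspace_add subspace_scale) auto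
    finally show ?thesis .
  qed
  then show ?thesis by blast
qed

lemma subspace_Ann: "subspace (cd_Ann n a)"
  by (auto simp: subspace_def Ann_iff cd_mult_linear)

lemma Ann_iff_P:
  assumes "a \<in> P" "a \<noteq> 0"
  shows "y \<in> cd_Ann n a \<longleftrightarrow> y \<in> P \<and> h (a \<odot> y) = 0 \<and> w (a \<odot> y) = 0"
proof
  assume "y \<in> cd_Ann n a"
  then show "y \<in> P \<and> h (a \<odot> y) = 0 \<and> w (a \<odot> y) = 0"
    using Ann_subset_P[OF assms] by (simp add: Ann_iff)
next
  assume "y \<in> P \<and> h (a \<odot> y) = 0 \<and> w (a \<odot> y) = 0"
  then show "y \<in> cd_Ann n a"
    using emb_h_add_w[of "a \<odot> y"] by (simp add: Ann_iff)
qed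

lemma dim_Ann_Times:
  "dim (cd_Ann n a \<times> cd_Ann n b \<times> {0 :: complex}) = dim (cd_Ann n a) + dim (cd_Ann n b)"
proof -
  let ?V = "cd_Ann n a \<times> cd_Ann n b \<times> {0 :: complex}"
  have V: "subspace ?V"
    using subspace_Times[OF subspace_Ann subspace_Times[OF subspace_Ann subspace_single_0]] .
  have "?V \<subseteq> A \<times> A \<times> UNIV"
    by (auto simp: Ann_iff)
  then obtain B where B: "finite B" "?V \<subseteq> span B"
    by (rule subset_span_carrier)
  have l: "linear (fst :: cd \<times> cd \<times> complex \<Rightarrow> cd)" "linear (fst \<circ> snd :: cd \<times> cd \<times> complex \<Rightarrow> cd)"
    by (auto intro!: linearI)
  have 0: "0 \<in> cd_Ann n a" for a
    by (simp add: Ann_iff)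
  let ?K = "{p \<in> ?V. fst p = 0}"
  have "?K = ?V \<inter> {p. fst p = 0}"
    by auto
  then have K: "subspace ?K"
    using subspace_inter[OF V linear_subspace_kernel[OF l(1)]] by (simp only:)
  have "fst ` ?V = cd_Ann n a"
    using 0 by force
  then have "dim ?V = dim (cd_Ann n a) + dim ?K"
    using rank_nullity[OF l(1) V B] by simp
  also have "dim ?K = dim ((fst \<circ> snd) ` ?K)"
    by (rule dim_inj_image[OF l(2) K B(1), symmetric]) (use B(2) in \<open>auto simp: zero_prod_def\<close>)
  also have "(fst \<circ> snd) ` ?K = cd_Ann n b"
    using 0 by force
  finally show ?thesis .
qed

text \<open>Reading off \<open>h (a \<odot> x)\<close> maps onto \<complex>, which gives the 2.
  Where it vanishes, the scalar equation forces \<open>h (b \<odot> y) = 0\<close> too, leaving a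
  pair of annihilator elements.\<close>

lemma dim_beta0_params:
  assumes ab: "a \<in> P" "b \<in> P" "a \<noteq> 0" "b \<noteq> 0"
  shows "dim (beta0_params a b) = 2 + dim (cd_Ann n a) + dim (cd_Ann n b)"
proof -
  define k :: "cd \<times> cd \<times> complex \<Rightarrow> complex" where "k = (\<lambda>(x, y, \<beta>). h (a \<odot> x))"
  have k: "linear k"
    by (rule linearI) (auto simp: k_def cd_mult_linear scaleR_conv_of_real)
  have "beta0_params a b \<subseteq> A \<times> A \<times> UNIV"
    by (auto simp: beta0_params_def)
  then obtain B where B: "finite B" "beta0_params a b \<subseteq> span B"
    by (rule subset_span_carrier)
  have "c \<in> k ` beta0_params a b" for c
  proof
    show "(solve a c, solve b (- cnj c), 0) \<in> beta0_params a b"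
      using solve[OF ab(1,3)] solve[OF ab(2,4)] by (simp add: beta0_params_def)
    show "c = k (solve a c, solve b (- cnj c), 0)"
      using solve[OF ab(1,3)] by (simp add: k_def)
  qed
  then have "k ` beta0_params a b = UNIV"
    by blast
  moreover have "{p \<in> beta0_params a b. k p = 0} = cd_Ann n a \<times> cd_Ann n b \<times> {0}"
  proof -
    have "p \<in> beta0_params a b \<and> k p = 0 \<longleftrightarrow> p \<in> cd_Ann n a \<times> cd_Ann n b \<times> {0}" for p
      by (cases p) (auto simp: beta0_params_def k_def Ann_iff_P[OF ab(1,3)] Ann_iff_P[OF ab(2,4)])
    then show ?thesis by blast
  qed
  ultimately show ?thesis
    using rank_nullity[OF k subspace_beta0_params B] by (simp add: dim_Ann_Times)
qed

text \<open>On the D-locus both terms vanish by \<open>in_D_ker\<close>. Off it some value is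
  nonzero, and the image is stable under \<i>, so it is all of \<complex>.\<close>

lemma image_defect:
  assumes ab: "a \<in> P" "b \<in> P" "a \<noteq> 0" "b \<noteq> 0"
  shows "defect a b ` beta0_params a b = (if in_D a b then {0} else UNIV)"
proof (cases "in_D a b")
  case True
  have "defect a b p = 0" if "p \<in> beta0_params a b" for p
    using that in_D_ker[OF ab(1,2,3) True] in_D_ker[OF ab(2,1,4)] True in_D_commute[OF ab(1,2)]
    by (auto simp: defect_def beta0_params_def)
  then have "defect a b ` beta0_params a b \<subseteq> {0}"
    by blast
  moreover have "0 \<in> defect a b ` beta0_params a b"
    using imageI[OF subspace_0[OF subspace_beta0_params], of "defect a b"] linear_0[OF linear_defect] by simp
  ultimately show ?thesis
    using True by auto
next
  case False
  have "\<exists>p\<in>beta0_params a b. defect a b p \<noteq> 0"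
  proof (rule ccontr)
    assume "\<not> ?thesis"
    then have 0: "h (a \<odot> y) = cnj (h (b \<odot> x))" if "(x, y, 0) \<in> beta0_params a b" for x y
      using that by (force simp: defect_def)
    have "h (a \<odot> y) = 0" if "y \<in> cd_Ann n b" for y
      using 0[of 0 y] that Ann_subset_P[OF ab(2,4) that] by (simp add: beta0_params_def Ann_iff)
    moreover have "h (b \<odot> x) = 0" if "x \<in> cd_Ann n a" for x
      using 0[of x 0] that Ann_subset_P[OF ab(1,3) that] by (simp add: beta0_params_def Ann_iff)
    moreover have "h (a \<odot> b) = 0"
    proof -
      \<comment> \<open>For this test pair the defect is \<open>h (a \<odot> b)\<close> times
        1/|a|^2 + 1/|b|^2.\<close>
      have "h (a \<odot> solve b (- 1)) = cnj (h (b \<odot> solve a 1))"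
        using solve[OF ab(1,3)] solve[OF ab(2,4)] by (intro 0) (simp add: beta0_params_def del: emb_linear)
      then have "h (a \<odot> b) * of_real (1 / ip a a + 1 / ip b b) = 0"
        using ab h_mul_commute[OF ab(1,2)] by (simp add: solve_def mul_sc field_simps)
      moreover have "1 / ip a a + 1 / ip b b > 0"
        using ip_pos ab by (intro add_pos_pos) auto
      ultimately show ?thesis
        by (metis less_irrefl mult_eq_0_iff of_real_eq_0_iff)
    qed
    ultimately show False
      using False by (simp add: in_D_def)
  qed
  then obtain p where p: "p \<in> beta0_params a b" "defect a b p \<noteq> 0" by blast
  have "\<i> * z \<in> defect a b ` beta0_params a b" if z: "z \<in> defect a b ` beta0_params a b" for z
  proof -
    obtain x y where xy: "(x, y, 0) \<in> beta0_params a b" "z = defect a b (x, y, 0)"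
      using z by (auto simp: beta0_params_def)
    show ?thesis
    proof
      \<comment> \<open>The opposite signs compensate the conjugation in the scalar equation and in
        the defect.\<close>
      show "(J x, - J y, 0) \<in> beta0_params a b"
        using xy(1) ab by (auto simp: beta0_params_def mul_J w_J add_eq_0_iff)
      show "\<i> * z = defect a b (J x, - J y, 0)"
        using xy ab by (auto simp: beta0_params_def defect_def mul_J right_diff_distrib)
    qed
  qed
  then have "defect a b ` beta0_params a b = UNIV"
    using complex_subspace_UNIV[OF linear_subspace_image[OF linear_defect subspace_beta0_params]] p by blast
  then show ?thesis
    using False by simp
qed

text \<open>The kernel of \<open>defect\<close> on \<open>beta0_params\<close> is that of the
  projection to \<beta> on \<open>Ann_params\<close>. With s the sum of the two annihilator
  dimensions, the count is 2 + (s + 2) - 0 on the D-locus and 0 + (s + 2) - 2 off it.\<close>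

lemma dim_Ann_params:
  assumes ab: "a \<in> P" "b \<in> P" "a \<noteq> 0" "b \<noteq> 0"
  shows "dim (Ann_params a b) = dim (cd_Ann n a) + dim (cd_Ann n b) + (if in_D a b then 4 else 0)"
proof -
  let ?f = "snd \<circ> snd :: cd \<times> cd \<times> complex \<Rightarrow> complex"
  have f: "linear ?f"
    by (auto intro!: linearI)
  have "Ann_params a b \<subseteq> A \<times> A \<times> UNIV" "beta0_params a b \<subseteq> A \<times> A \<times> UNIV"
    by (auto simp: Ann_params_def beta0_params_def)
  then obtain B B' where B: "finite B" "Ann_params a b \<subseteq> span B" "finite B'" "beta0_params a b \<subseteq> span B'"
    using subset_span_carrier by metis
  have "{p \<in> beta0_params a b. defect a b p = 0} = {p \<in> Ann_params a b. ?f p = 0}"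
    by (auto simp: beta0_params_def Ann_params_def defect_def)
  then have W: "dim (beta0_params a b) = dim (defect a b ` beta0_params a b) + dim {p \<in> Ann_params a b. ?f p = 0}"
    using rank_nullity[OF linear_defect subspace_beta0_params B(3,4)] by metis
  have Y: "dim (Ann_params a b) = dim (?f ` Ann_params a b) + dim {p \<in> Ann_params a b. ?f p = 0}"
    by (rule rank_nullity[OF f subspace_Ann_params B(1,2)])
  show ?thesis
  proof (cases "in_D a b")
    case True
    have "\<beta> \<in> ?f ` Ann_params a b" for \<beta>
      using in_D_imp_Ann_params[OF ab True, of \<beta>] by (metis comp_apply image_eqI snd_conv)
    then have "?f ` Ann_params a b = UNIV"
      by blast
    then show ?thesis
      using True W Y dim_beta0_params[OF ab] by (simp add: image_defect[OF ab] dim_zero_singleton)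
  next
    case False
    then have "?f p = 0" if "p \<in> Ann_params a b" for p
      using Ann_params_imp_in_D[OF ab] that by (cases p) auto
    then have "{p \<in> Ann_params a b. ?f p = 0} = Ann_params a b"
      by blast
    then show ?thesis
      using False W dim_beta0_params[OF ab] by (simp add: image_defect[OF ab])
  qed
qed

lemma linear_param_elem: "linear param_elem"
proof (rule linearI)
  show "param_elem (p + q) = param_elem p + param_elem q" for p q
    by (cases p; cases q) (simp add: param_elem_def cd_pair_linear(1)[symmetric] distrib_left algebra_simps)
  show "param_elem (r *\<^sub>R p) = r *\<^sub>R param_elem p" for r p
  proof (cases p)
    case (fields x y \<beta>)
    have "emb (\<i> * of_real (r * t)) = r *\<^sub>R emb (\<i> * of_real t)" for t
      by (simp add: emb_def)
    then show ?thesis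
      unfolding fields param_elem_def
      by (simp add: cd_pair_linear(2)[symmetric] scaleR_right_distrib scaleR_right_diff_distrib
          del: of_real_mult)
  qed
qed

text \<open>\<open>param_elem\<close> is injective on \<open>Ann_params\<close>: the C_n-components
  of the two halves determine \<beta>, and the \<open>P\<close>-components x + y and
  \<open>J (y - x)\<close> determine \<open>x\<close> and \<open>y\<close>.\<close>

lemma dim_Ann_brace:
  assumes ab: "a \<in> P" "b \<in> P" "a \<noteq> 0" "b \<noteq> 0"
  shows "dim (cd_Ann (Suc n) (cd_brace n a b)) =
    dim (cd_Ann n a) + dim (cd_Ann n b) + (if in_D a b then 4 else 0)"
proof -
  have "Ann_params a b \<subseteq> A \<times> A \<times> UNIV"
    by (auto simp: Ann_params_def)
  then obtain B where B: "finite B" "Ann_params a b \<subseteq> span B"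
    by (rule subset_span_carrier)
  have "p = 0" if p: "p \<in> Ann_params a b" "param_elem p = 0" for p
  proof (cases p)
    case (fields x y \<beta>)
    have xy: "x \<in> P" "y \<in> P"
      using p(1) by (simp_all add: fields Ann_params_def)
    have "emb (\<i> * of_real (Im \<beta>)) + (x + y) = 0" "emb (\<i> * of_real (Re \<beta>)) + J (y - x) = 0"
      using p(2) xy by (simp_all add: fields param_elem_def cd_pair_eq_0_iff add.commute)
    then have "\<beta> = 0" "x + y = 0" "J (y - x) = 0"
      using emb_add_eq_0_iff[of "x + y"] emb_add_eq_0_iff[of "J (y - x)"] xy
      by (simp_all add: complex_eq_iff)
    moreover from this have "y - x = 0"
      using J_J[of "y - x"] xy by simp
    ultimately show ?thesis
      using add_diff_eq_0_iff[of x x y] fields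
      by (simp add: zero_prod_def eq_neg_iff_add_eq_0[symmetric])
  qed
  then have "dim (param_elem ` Ann_params a b) = dim (Ann_params a b)"
    by (rule dim_inj_image[OF linear_param_elem subspace_Ann_params B])
  then show ?thesis
    by (simp add: Ann_brace[OF ab] dim_Ann_params[OF ab])
qed

end

theorem theorem1p5:
  fixes n :: nat and a b :: cd
  assumes "n \<ge> 1"
    and "a \<in> cd_C_perp n" and "b \<in> cd_C_perp n"
    and "a \<noteq> 0" and "b \<noteq> 0"
  shows "(cd_brace n a b \<notin> D_locus n \<longrightarrow>
            dim (cd_Ann (Suc n) (cd_brace n a b)) = dim (cd_Ann n a) + dim (cd_Ann n b))
       \<and> (cd_brace n a b \<in> D_locus n \<longrightarrow>
            dim (cd_Ann (Suc n) (cd_brace n a b)) = dim (cd_Ann n a) + dim (cd_Ann n b) + 4)"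
proof -
  interpret cayley_dickson n
    by unfold_locales (rule assms(1))
  show ?thesis
    using D_locus_iff[OF assms(2,3)] dim_Ann_brace[OF assms(2-5)] by simp
qed

end
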